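(* If the sum of the stockpile lengths is at most $3L/2$, then the problem of finding optimal stockpile positions and a corresponding minimum-makespan schedule for a single reclaimer, with stockpiles reclaimed in the prescribed order, can be solved in $O(n)$ time.
   Context: Single-reclaimer positioning problem with precedence. Two pads $P_1,P_2$ are each modeled as $[0,L]$, $L$ a positive integer. Given stockpile lengths $p_j\in\mathbb{Z}$, $0<p_j\le L$, $j=1,\dots,n$, one chooses for each stockpile a pad and an interval $[l_j,r_j]\subseteq[0,L]$ with $r_j-l_j=p_j$, stockpiles on the same pad non-overlapping, together with a schedule. Only reclaimer $R_0$ works, on a rail represented by $[0,L]$, starting and ending at $0$; reclaim speed $1$, travel speed $s\ge1$; its schedule is a continuous piecewise linear $H_0:[0,C]\to[0,L]$, $H_0(0)=H_0(C)=0$, with slopes in $\{0,\pm s,\pm1\}$ (slope $\pm1$ = reclaiming on either pad). Each stockpile is reclaimed by traversing all of $[l_j,r_j]$ once at speed $1$ in either direction, and the stockpiles must be reclaimed in order $1,2,\dots,n$. The objective is to minimize $C$. *)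

theory Defs
  imports Complex_Main "HOL-Library.Landau_Symbols"
begin

section \<open>The single-reclaimer positioning problem with precedence\<close>

definition reclaimer_instance :: "int \<Rightarrow> real \<Rightarrow> nat \<Rightarrow> (nat \<Rightarrow> int) \<Rightarrow> bool" where
  "reclaimer_instance L s n p \<longleftrightarrow>
     0 < L \<and> 1 \<le> s \<and> (\<forall>j\<in>{1..n}. 0 < p j \<and> p j \<le> L)"

text \<open>Stockpile \<open>j\<close> occupies the interval from \<open>l j\<close> to \<open>l j + p j\<close> on pad \<open>pad j\<close>.
  Left endpoints are arbitrary reals. Stockpiles on the same pad may touch at an endpoint.\<close>

definition valid_placement ::
  "int \<Rightarrow> nat \<Rightarrow> (nat \<Rightarrow> int) \<Rightarrow> (nat \<Rightarrow> nat) \<Rightarrow> (nat \<Rightarrow> real) \<Rightarrow> bool" where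
  "valid_placement L n p pad l \<longleftrightarrow>
     (\<forall>j\<in>{1..n}. pad j \<in> {1, 2} \<and> 0 \<le> l j \<and> l j + of_int (p j) \<le> of_int L) \<and>
     (\<forall>i\<in>{1..n}. \<forall>j\<in>{1..n}. i \<noteq> j \<and> pad i = pad j \<longrightarrow>
        l i + of_int (p i) \<le> l j \<or> l j + of_int (p j) \<le> l i)"

definition breakpoints :: "real \<Rightarrow> nat \<Rightarrow> (nat \<Rightarrow> real) \<Rightarrow> bool" where
  "breakpoints C m t \<longleftrightarrow> t 0 = 0 \<and> t m = C \<and> (\<forall>i<m. t i < t (Suc i))"

definition affine_piece :: "(real \<Rightarrow> real) \<Rightarrow> real \<Rightarrow> real \<Rightarrow> real \<Rightarrow> bool" where
  "affine_piece H a b \<sigma> \<longleftrightarrow> (\<forall>u\<in>{a..b}. H u = H a + \<sigma> * (u - a))"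

text \<open>During the time window from \<open>a\<close> to \<open>a + q\<close> the reclaimer traverses the interval
  from \<open>x\<close> to \<open>x + q\<close> at speed 1, from left to right or from right to left.\<close>

definition traverses :: "(real \<Rightarrow> real) \<Rightarrow> real \<Rightarrow> real \<Rightarrow> real \<Rightarrow> bool" where
  "traverses H a x q \<longleftrightarrow>
     (\<forall>u\<in>{0..q}. H (a + u) = x + u) \<or> (\<forall>u\<in>{0..q}. H (a + u) = x + q - u)"

text \<open>A schedule \<open>H\<close> of makespan \<open>C\<close>; only the values of \<open>H\<close> between \<open>0\<close> and \<open>C\<close> matter.
  The pieces are closed intervals sharing their endpoints, so \<open>H\<close> is continuous there.
  The reclaiming of stockpile \<open>j\<close> starts at time \<open>a j\<close>. As slope 1 or -1 means reclaiming,
  a piece whose slope is none of \<open>0\<close>, \<open>s\<close>, \<open>- s\<close> must lie in the time window of some stockpile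
  (for \<open>s = 1\<close> travelling and reclaiming have the same slopes).\<close>

definition valid_schedule ::
  "int \<Rightarrow> real \<Rightarrow> nat \<Rightarrow> (nat \<Rightarrow> int) \<Rightarrow> (nat \<Rightarrow> real) \<Rightarrow> real \<Rightarrow> (real \<Rightarrow> real) \<Rightarrow> bool" where
  "valid_schedule L s n p l C H \<longleftrightarrow>
     0 \<le> C \<and> H 0 = 0 \<and> H C = 0 \<and>
     (\<forall>u\<in>{0..C}. 0 \<le> H u \<and> H u \<le> of_int L) \<and>
     (\<exists>m t \<sigma> a.
        breakpoints C m t \<and>
        (\<forall>i<m. \<sigma> i \<in> {0, s, - s, 1, - 1} \<and> affine_piece H (t i) (t (Suc i)) (\<sigma> i)) \<and>
        (\<forall>j\<in>{1..n}. 0 \<le> a j \<and> a j + of_int (p j) \<le> C \<and>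
           traverses H (a j) (l j) (of_int (p j))) \<and>
        (\<forall>j\<in>{1..<n}. a j + of_int (p j) \<le> a (Suc j)) \<and>
        (\<forall>i<m. \<sigma> i \<notin> {0, s, - s} \<longrightarrow>
           (\<exists>j\<in>{1..n}. {t i..t (Suc i)} \<subseteq> {a j..a j + of_int (p j)})))"

definition feasible_solution ::
  "int \<Rightarrow> real \<Rightarrow> nat \<Rightarrow> (nat \<Rightarrow> int) \<Rightarrow>
   (nat \<Rightarrow> nat) \<Rightarrow> (nat \<Rightarrow> real) \<Rightarrow> real \<Rightarrow> (real \<Rightarrow> real) \<Rightarrow> bool" where
  "feasible_solution L s n p pad l C H \<longleftrightarrow>
     valid_placement L n p pad l \<and> valid_schedule L s n p l C H"

definition optimal_solution ::
  "int \<Rightarrow> real \<Rightarrow> nat \<Rightarrow> (nat \<Rightarrow> int) \<Rightarrow>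
   (nat \<Rightarrow> nat) \<Rightarrow> (nat \<Rightarrow> real) \<Rightarrow> real \<Rightarrow> (real \<Rightarrow> real) \<Rightarrow> bool" where
  "optimal_solution L s n p pad l C H \<longleftrightarrow>
     feasible_solution L s n p pad l C H \<and>
     (\<forall>pad' l' C' H'. feasible_solution L s n p pad' l' C' H' \<longrightarrow> C \<le> C')"

section \<open>The model of computation\<close>

text \<open>A unit-cost real RAM, presented as a while language. There are two sorts of memory: natural
  numbers (for counters, indices and pad numbers) and reals (for lengths, positions and times).
  The reals support field operations and comparisons; there is no rounding and no conversion
  between the sorts, and program constants are integers. Every variable and operator occurrence
  that is evaluated is charged one time unit, as is every command and every loop test.\<close>

type_synonym vname = string

record state =
  ivar :: "vname \<Rightarrow> nat"
  rvar :: "vname \<Rightarrow> real"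
  iarr :: "vname \<Rightarrow> nat \<Rightarrow> nat"
  rarr :: "vname \<Rightarrow> nat \<Rightarrow> real"

datatype iexp =
    IConst nat
  | IVar vname
  | IGet vname iexp
  | IAdd iexp iexp
  | ISub iexp iexp

datatype rexp =
    RConst int
  | RVar vname
  | RGet vname iexp
  | RAdd rexp rexp
  | RSub rexp rexp
  | RMul rexp rexp
  | RDiv rexp rexp

datatype bexp =
    ILess iexp iexp
  | RLess rexp rexp
  | BNot bexp
  | BAnd bexp bexp

datatype com =
    Skip
  | IAssign vname iexp
  | RAssign vname rexp
  | IStore vname iexp iexp
  | RStore vname iexp rexp
  | Seq com com
  | Cond bexp com com
  | While bexp com

text \<open>Subtraction of natural numbers is truncated, and real division by zero yields zero.\<close>

primrec ival :: "iexp \<Rightarrow> state \<Rightarrow> nat" where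
  "ival (IConst c) st = c"
| "ival (IVar x) st = ivar st x"
| "ival (IGet x e) st = iarr st x (ival e st)"
| "ival (IAdd e f) st = ival e st + ival f st"
| "ival (ISub e f) st = ival e st - ival f st"

primrec rval :: "rexp \<Rightarrow> state \<Rightarrow> real" where
  "rval (RConst c) st = of_int c"
| "rval (RVar x) st = rvar st x"
| "rval (RGet x e) st = rarr st x (ival e st)"
| "rval (RAdd e f) st = rval e st + rval f st"
| "rval (RSub e f) st = rval e st - rval f st"
| "rval (RMul e f) st = rval e st * rval f st"
| "rval (RDiv e f) st = rval e st / rval f st"

primrec bval :: "bexp \<Rightarrow> state \<Rightarrow> bool" where
  "bval (ILess e f) st \<longleftrightarrow> ival e st < ival f st"
| "bval (RLess e f) st \<longleftrightarrow> rval e st < rval f st"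
| "bval (BNot b) st \<longleftrightarrow> \<not> bval b st"
| "bval (BAnd b c) st \<longleftrightarrow> bval b st \<and> bval c st"

primrec icost :: "iexp \<Rightarrow> nat" where
  "icost (IConst c) = 1"
| "icost (IVar x) = 1"
| "icost (IGet x e) = 1 + icost e"
| "icost (IAdd e f) = 1 + icost e + icost f"
| "icost (ISub e f) = 1 + icost e + icost f"

primrec rcost :: "rexp \<Rightarrow> nat" where
  "rcost (RConst c) = 1"
| "rcost (RVar x) = 1"
| "rcost (RGet x e) = 1 + icost e"
| "rcost (RAdd e f) = 1 + rcost e + rcost f"
| "rcost (RSub e f) = 1 + rcost e + rcost f"
| "rcost (RMul e f) = 1 + rcost e + rcost f"
| "rcost (RDiv e f) = 1 + rcost e + rcost f"

primrec bcost :: "bexp \<Rightarrow> nat" where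
  "bcost (ILess e f) = 1 + icost e + icost f"
| "bcost (RLess e f) = 1 + rcost e + rcost f"
| "bcost (BNot b) = 1 + bcost b"
| "bcost (BAnd b c) = 1 + bcost b + bcost c"

text \<open>\<open>exec c st k st'\<close>: started in \<open>st\<close>, the program \<open>c\<close> terminates in \<open>st'\<close> after
  \<open>k\<close> time units.\<close>

inductive exec :: "com \<Rightarrow> state \<Rightarrow> nat \<Rightarrow> state \<Rightarrow> bool" where
  exec_Skip: "exec Skip st 1 st"
| exec_IAssign:
    "exec (IAssign x e) st (1 + icost e) (st\<lparr>ivar := (ivar st)(x := ival e st)\<rparr>)"
| exec_RAssign:
    "exec (RAssign x e) st (1 + rcost e) (st\<lparr>rvar := (rvar st)(x := rval e st)\<rparr>)"
| exec_IStore: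
    "exec (IStore x d e) st (1 + icost d + icost e)
       (st\<lparr>iarr := (iarr st)(x := (iarr st x)(ival d st := ival e st))\<rparr>)"
| exec_RStore:
    "exec (RStore x d e) st (1 + icost d + rcost e)
       (st\<lparr>rarr := (rarr st)(x := (rarr st x)(ival d st := rval e st))\<rparr>)"
| exec_Seq:
    "exec c st k st' \<Longrightarrow> exec d st' k' st'' \<Longrightarrow> exec (Seq c d) st (1 + k + k') st''"
| exec_CondTrue:
    "bval b st \<Longrightarrow> exec c st k st' \<Longrightarrow> exec (Cond b c d) st (1 + bcost b + k) st'"
| exec_CondFalse:
    "\<not> bval b st \<Longrightarrow> exec d st k st' \<Longrightarrow> exec (Cond b c d) st (1 + bcost b + k) st'"
| exec_WhileFalse:
    "\<not> bval b st \<Longrightarrow> exec (While b c) st (1 + bcost b) st"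
| exec_WhileTrue:
    "bval b st \<Longrightarrow> exec c st k st' \<Longrightarrow> exec (While b c) st' k' st'' \<Longrightarrow>
     exec (While b c) st (1 + bcost b + k + k') st''"

section \<open>Input and output\<close>

text \<open>All memory that does not hold input data is initialised with zero.\<close>

definition input_state :: "int \<Rightarrow> real \<Rightarrow> nat \<Rightarrow> (nat \<Rightarrow> int) \<Rightarrow> state" where
  "input_state L s n p =
     \<lparr>ivar = (\<lambda>_. 0)(''n'' := n),
      rvar = (\<lambda>_. 0)(''L'' := of_int L, ''s'' := s),
      iarr = (\<lambda>_ _. 0),
      rarr = (\<lambda>_ _. 0)(''p'' := (\<lambda>j. if j \<in> {1..n} then of_int (p j) else 0))\<rparr>"

text \<open>\<open>H\<close> is the piecewise linear function through the points \<open>(t i, x i)\<close>, \<open>i = 0, \<dots>, m\<close>.\<close>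

definition interpolates :: "nat \<Rightarrow> (nat \<Rightarrow> real) \<Rightarrow> (nat \<Rightarrow> real) \<Rightarrow> (real \<Rightarrow> real) \<Rightarrow> bool" where
  "interpolates m t x H \<longleftrightarrow>
     (\<forall>i\<le>m. H (t i) = x i) \<and> (\<forall>i<m. \<exists>\<sigma>. affine_piece H (t i) (t (Suc i)) \<sigma>)"

text \<open>The output consists of the pads and left endpoints of the stockpiles (arrays \<open>pad\<close> and \<open>l\<close>)
  and of the schedule, given by its breakpoints \<open>(t i, x i)\<close>, \<open>i = 0, \<dots>, m\<close>.\<close>

definition outputs_solution ::
  "state \<Rightarrow> nat \<Rightarrow> (nat \<Rightarrow> nat) \<Rightarrow> (nat \<Rightarrow> real) \<Rightarrow> real \<Rightarrow> (real \<Rightarrow> real) \<Rightarrow> bool" where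
  "outputs_solution st n pad l C H \<longleftrightarrow>
     (\<forall>j\<in>{1..n}. pad j = iarr st ''pad'' j \<and> l j = rarr st ''l'' j) \<and>
     breakpoints C (ivar st ''m'') (rarr st ''t'') \<and>
     interpolates (ivar st ''m'') (rarr st ''t'') (rarr st ''x'') H"

end

theory Submission
  imports Defs "HOL-Analysis.Analysis"
begin

text \<open>Let \<open>P\<close> be the sum of the stockpile lengths. Reclaiming takes time \<open>P\<close>, so a schedule in
  which the reclaimer covers the total distance \<open>D\<close> has makespan at least \<open>P + (D - P) / s\<close>.
  Fix a stockpile \<open>k\<close> of length \<open>b\<close>, and let \<open>a\<close> and \<open>c\<close> be the total lengths of the stockpiles
  before and after it. Then \<open>D \<ge> 2 * min (a + b) (b + c)\<close>: the path before the reclaiming of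
  \<open>k\<close> and the path after it cross a position an even or odd number of times depending only on
  the endpoints of \<open>k\<close>, and every position is covered by at most two stockpiles, at most one
  besides \<open>k\<close> inside the interval of \<open>k\<close>. Comparing the number of crossings with the number of
  covering stockpiles at each position and integrating gives \<open>D \<ge> 2 * (a + b)\<close> if the first path
  does not reach farther than the second one, and \<open>D \<ge> 2 * (b + c)\<close> otherwise.

  The bound is attained for the first \<open>k\<close> with \<open>2 * (a + b) \<ge> P\<close>. By symmetry let \<open>a \<le> c\<close>.
  The stockpiles before \<open>k\<close> are reclaimed on the way out over \<open>[0, a]\<close>. If \<open>a + b \<le> L\<close>, then \<open>k\<close>
  continues on the same pad up to \<open>a + b\<close> and the rest fills \<open>[0, c]\<close> of the other pad on the
  way back. Otherwise \<open>k\<close> takes \<open>[L - b, L]\<close> on the other pad, and the rest takes \<open>[a, a + c]\<close>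
  on the first one, which fits because \<open>P \<le> 3 * L / 2\<close>. In both cases \<open>D = 2 * (a + b)\<close>.\<close>

section \<open>The lower bound\<close>

definition cross :: "real \<Rightarrow> real \<Rightarrow> real \<Rightarrow> nat" where
  "cross u v y = (if u < y \<and> y < v \<or> v < y \<and> y < u then 1 else 0)"

text \<open>Integrating over all positions turns crossing counts into distances. A move does not
  cross its two end positions, which form a null set.\<close>

lemma has_integral_cross: "((\<lambda>y. real (cross u v y)) has_integral \<bar>v - u\<bar>) UNIV"
proof -
  have "((\<lambda>y. if y \<in> {min u v..max u v} then 1 else 0 :: real) has_integral \<bar>v - u\<bar>) UNIV"
    using has_integral_const_real[of "1::real" "min u v" "max u v"]
    by (subst has_integral_restrict_UNIV) (auto simp: min_def max_def split: if_splits)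
  then show ?thesis
    by (rule has_integral_spike_finite[of "{u, v}", rotated 2])
       (auto simp: cross_def min_def max_def split: if_splits)
qed

definition crossings :: "(nat \<Rightarrow> real) \<Rightarrow> nat \<Rightarrow> nat \<Rightarrow> real \<Rightarrow> nat" where
  "crossings z i m y = (\<Sum>h=i..<m. cross (z h) (z (Suc h)) y)"

lemma crossings_split: "i \<le> h \<Longrightarrow> h \<le> m \<Longrightarrow> crossings z i m y = crossings z i h y + crossings z h m y"
  unfolding crossings_def by (simp add: sum.atLeastLessThan_concat)

lemma has_integral_crossings:
  "((\<lambda>y. real (crossings z i m y)) has_integral (\<Sum>h=i..<m. \<bar>z (Suc h) - z h\<bar>)) UNIV"
  unfolding crossings_def of_nat_sum
  by (intro has_integral_sum has_integral_cross) simp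

text \<open>Each crossing of \<open>y\<close> changes the side, so the parity of the count records
  whether the two ends lie on the same side.\<close>

lemma even_crossings:
  assumes "i \<le> m" "\<And>h. h \<in> {i..m} \<Longrightarrow> z h \<noteq> y"
  shows "even (crossings z i m y) \<longleftrightarrow> (y < z i \<longleftrightarrow> y < z m)"
  using assms
proof (induction m rule: dec_induct)
  case base
  then show ?case by (simp add: crossings_def)
next
  case (step m)
  have "crossings z i (Suc m) y = crossings z i m y + cross (z m) (z (Suc m)) y"
    using step.hyps by (simp add: crossings_def)
  moreover have "even (cross (z m) (z (Suc m)) y) \<longleftrightarrow> (y < z m \<longleftrightarrow> y < z (Suc m))"
    using step.prems[of m] step.prems[of "Suc m"] step.hyps by (auto simp: cross_def)
  ultimately show ?case using step by auto
qed

text \<open>The vertex \<open>z h\<close> lies above \<open>y\<close> and one end of the path below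
  it, so the part of the path between these two crosses \<open>y\<close> an odd number of
  times.\<close>

lemma crossings_pos:
  assumes "h \<in> {i..m}" "y < z h" "z i < y \<or> z m < y" "\<And>h. h \<in> {i..m} \<Longrightarrow> z h \<noteq> y"
  shows "0 < crossings z i m y"
proof -
  have "odd (crossings z i h y) \<or> odd (crossings z h m y)"
    using even_crossings[of i h z y] even_crossings[of h m z y] assms by auto
  moreover have "crossings z i m y = crossings z i h y + crossings z h m y"
    using assms(1) by (intro crossings_split) auto
  ultimately show ?thesis by (auto intro: odd_pos)
qed

text \<open>A move that crosses \<open>y\<close> has an end above \<open>y\<close>, hence above
  \<open>y'\<close>. Thus the positions crossed by a path are closed downwards, as long as an end of
  the path lies below them.\<close>

lemma crossings_antimono:
  assumes "0 < crossings z i m y" "y' \<le> y" "z i < y' \<or> z m < y'"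
    and "\<And>h. h \<in> {i..m} \<Longrightarrow> z h \<noteq> y'"
  shows "0 < crossings z i m y'"
proof -
  obtain h where h: "h \<in> {i..<m}" "0 < cross (z h) (z (Suc h)) y"
  proof -
    have "\<not> (\<forall>h\<in>{i..<m}. cross (z h) (z (Suc h)) y = 0)"
    proof
      assume "\<forall>h\<in>{i..<m}. cross (z h) (z (Suc h)) y = 0"
      then have "crossings z i m y = 0" unfolding crossings_def by (intro sum.neutral)
      then show False using assms(1) by simp
    qed
    then show ?thesis using that by blast
  qed
  then have "y' < z h \<or> y' < z (Suc h)"
    using assms(2) by (auto simp: cross_def split: if_splits)
  moreover have "h \<in> {i..m}" "Suc h \<in> {i..m}" using h(1) by auto
  ultimately obtain g where "g \<in> {i..m}" "y' < z g" by blast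
  then show ?thesis using assms(3,4) by (rule crossings_pos)
qed

section \<open>Lower bound for the length of a walk\<close>

lemma sum_even_odd:
  fixes f :: "nat \<Rightarrow> 'a::comm_monoid_add"
  shows "(\<Sum>i=0..<2 * n + 1. f i) = (\<Sum>j=1..n. f (2 * j - 1)) + (\<Sum>j=0..n. f (2 * j))"
  by (induction n) (simp_all add: ac_simps)

text \<open>The odd moves given by \<open>J\<close> are distinct moves of the path from vertex
  \<open>i\<close> to vertex \<open>m\<close>; \<open>1 \<le> j\<close> keeps the subtraction
  exact.\<close>

lemma odd_moves_le_crossings:
  assumes "\<And>j. j \<in> J \<Longrightarrow> 1 \<le> j \<and> i \<le> 2 * j - 1 \<and> 2 * j - 1 < m"
  shows "(\<Sum>j\<in>J. cross (z (2 * j - 1)) (z (2 * j)) y) \<le> crossings z i m y"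
proof -
  have inj: "inj_on (\<lambda>j. 2 * j - 1) J"
  proof (rule inj_onI)
    fix i j assume "i \<in> J" "j \<in> J" "2 * i - 1 = 2 * j - 1"
    then show "i = j" using assms[of i] assms[of j] by linarith
  qed
  have "(\<Sum>j\<in>J. cross (z (2 * j - 1)) (z (2 * j)) y)
      = (\<Sum>j\<in>J. cross (z (2 * j - 1)) (z (Suc (2 * j - 1))) y)"
  proof (rule sum.cong)
    fix j assume "j \<in> J"
    then have "Suc (2 * j - 1) = 2 * j" using assms[of j] by linarith
    then show "cross (z (2 * j - 1)) (z (2 * j)) y = cross (z (2 * j - 1)) (z (Suc (2 * j - 1))) y"
      by simp
  qed simp
  also have "\<dots> = (\<Sum>h\<in>(\<lambda>j. 2 * j - 1) ` J. cross (z h) (z (Suc h)) y)"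
    using inj by (simp add: sum.reindex)
  also have "\<dots> \<le> crossings z i m y"
    unfolding crossings_def using assms by (intro sum_mono2) auto
  finally show ?thesis .
qed

text \<open>Parity forces a third crossing at a position that is covered twice from one side of
  the moves; where parity does not help, the hypothesis \<open>far\<close> does.\<close>

lemma crossing_count_bound:
  fixes n1 n2 c1 :: nat and y u w :: real
  assumes par: "even n1 \<longleftrightarrow> \<not> y < u" "even n2 \<longleftrightarrow> \<not> y < w"
    and cover: "c1 \<le> n1" "c1 + cross u w y \<le> 2" and ne: "y \<noteq> u" "y \<noteq> w"
    and far: "0 < n1 \<Longrightarrow> 0 < n2"
  shows "2 * (c1 + cross u w y) \<le> n1 + cross u w y + n2"
proof -
  \<comment> \<open>The claim reduces to \<open>2 * c1 + cross u w y \<le> n1 + n2\<close>. If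
    \<open>c1 = 2\<close>, then \<open>cross u w y = 0\<close>, so \<open>n1\<close> and
    \<open>n2\<close> have equal parity: both are even and at least 2, or both are odd and
    \<open>n1 \<ge> 3\<close>. If \<open>c1 = 1\<close>, both counts are positive, and a crossing by
    the middle move makes their sum odd, hence at least 3.\<close>
  have "c1 = 0 \<or> c1 = 1 \<or> c1 = 2" using cover by auto
  moreover have "y < u \<Longrightarrow> n1 \<noteq> 0 \<and> n1 \<noteq> 2" "\<not> y < u \<Longrightarrow> n1 \<noteq> 1"
     "y < w \<Longrightarrow> n2 \<noteq> 0" "\<not> y < w \<Longrightarrow> n2 \<noteq> 1" using par by (auto elim!: oddE)
  ultimately show ?thesis using cover far ne by (auto simp: cross_def split: if_splits)
qed

lemma has_integral_le_off_finite:
  assumes "(f has_integral a) UNIV" "(g has_integral b) UNIV" "finite F"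
    and "\<And>y :: real. y \<notin> F \<Longrightarrow> f y \<le> (g y :: real)"
  shows "a \<le> b"
proof (rule has_integral_le)
  show "(f has_integral a) UNIV" by fact
  show "((\<lambda>y. if y \<in> F then f y else g y) has_integral b) UNIV"
    using assms by (intro has_integral_spike_finite[OF \<open>finite F\<close> _ assms(2)]) auto
qed (use assms in auto)

text \<open>The moves of a walk \<open>z\<close> from 0 to 0 are numbered from 0; the odd moves reclaim the
  stockpiles.\<close>

lemma walk_length_bound:
  fixes z :: "nat \<Rightarrow> real"
  assumes z: "z 0 = 0" "z (2 * n + 1) = 0" "\<And>i. i \<le> 2 * n + 1 \<Longrightarrow> 0 \<le> z i"
    and twice: "\<And>y. (\<Sum>j=1..n. cross (z (2 * j - 1)) (z (2 * j)) y) \<le> 2"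
    and k: "k \<in> {1..n}"
  defines "q \<equiv> \<lambda>j. \<bar>z (2 * j) - z (2 * j - 1)\<bar>"
  shows "2 * min (\<Sum>j=1..k. q j) (\<Sum>j=k..n. q j) \<le> (\<Sum>i=0..<2 * n + 1. \<bar>z (Suc i) - z i\<bar>)"
proof -
  define F where "F = z ` {0..2 * n + 1}"
  define N where "N = crossings z 0 (2 * n + 1)"
  define n1 where "n1 = crossings z 0 (2 * k - 1)"
  define n2 where "n2 = crossings z (2 * k) (2 * n + 1)"
  define X where "X = (\<lambda>j. cross (z (2 * j - 1)) (z (2 * j)))"
  define c1 where "c1 = (\<lambda>y. \<Sum>j=1..<k. X j y)"
  define c2 where "c2 = (\<lambda>y. \<Sum>j=Suc k..n. X j y)"
  let ?u = "z (2 * k - 1)" and ?w = "z (2 * k)"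
  have Suc_k: "Suc (2 * k - 1) = 2 * k" using k by auto
  have F: "finite F" "\<And>h y. y \<notin> F \<Longrightarrow> h \<le> 2 * n + 1 \<Longrightarrow> z h \<noteq> y"
    unfolding F_def by auto
  \<comment> \<open>Move \<open>2 * k - 1\<close> reclaims \<open>k\<close> and splits the walk into
    a path before it and a path after it.\<close>
  have N: "N y = n1 y + X k y + n2 y" for y
  proof -
    have "N y = n1 y + crossings z (2 * k - 1) (2 * n + 1) y"
      unfolding N_def n1_def using k by (intro crossings_split) auto
    also have "crossings z (2 * k - 1) (2 * n + 1) y
        = crossings z (2 * k - 1) (2 * k) y + crossings z (2 * k) (2 * n + 1) y"
      using k by (intro crossings_split) auto
    also have "crossings z (2 * k - 1) (2 * k) y = X k y"
    proof -
      have "crossings z h (Suc h) y = cross (z h) (z (Suc h)) y" for h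
        by (simp add: crossings_def)
      from this[of "2 * k - 1"] show ?thesis by (simp only: Suc_k X_def)
    qed
    finally show ?thesis by (simp add: n2_def)
  qed
  have c_le: "c1 y \<le> n1 y" "c2 y \<le> n2 y" for y
    unfolding c1_def c2_def n1_def n2_def X_def using k
    by (intro odd_moves_le_crossings; auto)+
  have range: "{1..n} = {1..<k} \<union> {k} \<union> {Suc k..n}" using k by auto
  have "(\<Sum>j=1..n. X j y) = c1 y + X k y + c2 y" for y
    unfolding range c1_def c2_def by (subst sum.union_disjoint; force)+
  then have cover: "c1 y + X k y + c2 y \<le> 2" for y
    using twice[of y] by (simp add: X_def)
  have parity: "even (n1 y) \<longleftrightarrow> \<not> y < ?u" "even (n2 y) \<longleftrightarrow> \<not> y < ?w"
    if "y \<notin> F" "0 < y" for y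
    unfolding n1_def n2_def
    using even_crossings[of 0 "2 * k - 1" z y] even_crossings[of "2 * k" "2 * n + 1" z y]
      F(2)[OF that(1)] that(2) z(1,2) k by auto
  have anti: "0 < n1 y'" if "0 < n1 y" "y' \<le> y" "y' \<notin> F" "0 < y'" for y y'
    using that(1) unfolding n1_def
  proof (rule crossings_antimono)
    show "z h \<noteq> y'" if "h \<in> {0..2 * k - 1}" for h
    proof -
      have "h \<le> 2 * n + 1" using that k by (simp only: atLeastAtMost_iff) linarith
      then show ?thesis using F(2)[OF \<open>y' \<notin> F\<close>] by blast
    qed
  qed (use that z in auto)
  have anti': "0 < n2 y'" if "0 < n2 y" "y' \<le> y" "y' \<notin> F" "0 < y'" for y y'
    using that(1) unfolding n2_def
  proof (rule crossings_antimono)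
    show "z h \<noteq> y'" if "h \<in> {2 * k..2 * n + 1}" for h
      using F(2)[OF \<open>y' \<notin> F\<close>, of h] that k by auto
  qed (use that z in auto)
  \<comment> \<open>Up to vertices, the positive positions crossed by either path form an initial
    segment, by \<open>anti\<close> and \<open>anti'\<close>. Of two initial segments one contains
    the other, which decides which path does not reach farther.\<close>
  have far: "(\<forall>y. y \<notin> F \<and> 0 < y \<and> 0 < n1 y \<longrightarrow> 0 < n2 y) \<or>
             (\<forall>y. y \<notin> F \<and> 0 < y \<and> 0 < n2 y \<longrightarrow> 0 < n1 y)"
    using anti anti' by (meson linear)
  have neg: "X j y = 0" if "y \<le> 0" "j \<in> {1..n}" for j y
  proof -
    have "2 * j - 1 \<le> 2 * n + 1" "2 * j \<le> 2 * n + 1" using that by auto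
    then have "0 \<le> z (2 * j - 1)" "0 \<le> z (2 * j)" using z(3) by blast+
    then show ?thesis using that(1) by (simp add: X_def cross_def)
  qed
  have X_int: "((\<lambda>y. real (X j y)) has_integral q j) UNIV" for j
    unfolding X_def q_def by (rule has_integral_cross)
  have N_int: "((\<lambda>y. real (N y)) has_integral (\<Sum>i=0..<2 * n + 1. \<bar>z (Suc i) - z i\<bar>)) UNIV"
    unfolding N_def by (rule has_integral_crossings)
  \<comment> \<open>Only positive positions off the vertices need a comparison: the vertices are
    nonnegative, so no reclaiming move crosses a position \<open>y \<le> 0\<close>.\<close>
  have le: "2 * (\<Sum>j\<in>J. q j) \<le> (\<Sum>i=0..<2 * n + 1. \<bar>z (Suc i) - z i\<bar>)"
    if J: "J \<subseteq> {1..n}" and b: "\<And>y. y \<notin> F \<Longrightarrow> 0 < y \<Longrightarrow> 2 * (\<Sum>j\<in>J. X j y) \<le> N y" for J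
  proof (rule has_integral_le_off_finite[OF _ N_int F(1)])
    have fin: "finite J" using J finite_subset by blast
    show "((\<lambda>y. real (2 * (\<Sum>j\<in>J. X j y))) has_integral 2 * (\<Sum>j\<in>J. q j)) UNIV"
      unfolding of_nat_mult of_nat_sum
      using has_integral_mult_right[OF has_integral_sum[OF fin X_int], of 2] by simp
    show "real (2 * (\<Sum>j\<in>J. X j y)) \<le> real (N y)" if "y \<notin> F" for y
    proof (cases "0 < y")
      case True
      then show ?thesis using b that by (simp only: of_nat_le_iff)
    next
      case False
      then have "(\<Sum>j\<in>J. X j y) = 0" using neg J by (intro sum.neutral) auto
      then show ?thesis by simp
    qed
  qed
  have ne: "y \<noteq> ?u" "y \<noteq> ?w" if "y \<notin> F" for y
  proof -
    have "2 * k - 1 \<le> 2 * n + 1" "2 * k \<le> 2 * n + 1" using k by auto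
    then show "y \<noteq> ?u" "y \<noteq> ?w" using F(2)[OF that] by metis+
  qed
  from far show ?thesis
  proof
    assume far1: "\<forall>y. y \<notin> F \<and> 0 < y \<and> 0 < n1 y \<longrightarrow> 0 < n2 y"
    have "2 * (\<Sum>j=1..k. q j) \<le> (\<Sum>i=0..<2 * n + 1. \<bar>z (Suc i) - z i\<bar>)"
    proof (rule le)
      fix y assume y: "y \<notin> F" "0 < y"
      have "(\<Sum>j=1..k. X j y) = c1 y + X k y"
        unfolding c1_def using k by (simp add: sum.last_plus ac_simps atLeastLessThanSuc_atLeastAtMost[symmetric])
      then show "2 * (\<Sum>j=1..k. X j y) \<le> N y"
        using crossing_count_bound[OF parity[OF y] c_le(1) _ ne[OF y(1)]] far1 y cover[of y] N[of y]
        by (auto simp: X_def)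
    qed (use k in auto)
    then show ?thesis by linarith
  next
    assume far2: "\<forall>y. y \<notin> F \<and> 0 < y \<and> 0 < n2 y \<longrightarrow> 0 < n1 y"
    have "2 * (\<Sum>j=k..n. q j) \<le> (\<Sum>i=0..<2 * n + 1. \<bar>z (Suc i) - z i\<bar>)"
    proof (rule le)
      fix y assume y: "y \<notin> F" "0 < y"
      have "(\<Sum>j=k..n. X j y) = X k y + c2 y"
        unfolding c2_def using k by (simp add: sum.atLeast_Suc_atMost)
      \<comment> \<open>Reversing the walk exchanges \<open>n1\<close> with \<open>n2\<close>,
        \<open>c1\<close> with \<open>c2\<close> and the two ends of the move.\<close>
      moreover have "X k y = cross ?w ?u y" by (auto simp: X_def cross_def)
      ultimately show "2 * (\<Sum>j=k..n. X j y) \<le> N y"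
        using crossing_count_bound[OF parity(2,1)[OF y] c_le(2) _ ne(2,1)[OF y(1)]]
          far2 y cover[of y] N[of y] by auto
    qed (use k in auto)
    then show ?thesis by linarith
  qed
qed

section \<open>From schedules to walks\<close>

lemma interval_count_le_2:
  assumes "\<And>j. j \<in> {1..n} \<Longrightarrow> 0 < p j" "valid_placement L n p pad l"
    and "\<And>j. j \<in> {1..n} \<Longrightarrow>
      f j = l j \<and> g j = l j + real_of_int (p j) \<or> f j = l j + real_of_int (p j) \<and> g j = l j"
  shows "(\<Sum>j=1..n. cross (f j) (g j) y) \<le> 2"
proof -
  define J where "J = {j \<in> {1..n}. l j < y \<and> y < l j + real_of_int (p j)}"
  have "(\<Sum>j=1..n. cross (f j) (g j) y) = (\<Sum>j=1..n. if j \<in> J then 1 else 0)"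
  proof (rule sum.cong)
    fix j assume j: "j \<in> {1..n}"
    show "cross (f j) (g j) y = (if j \<in> J then 1 else 0)"
      using assms(3)[OF j] assms(1)[OF j] j by (auto simp: J_def cross_def)
  qed simp
  also have "\<dots> = card ({1..n} \<inter> J)" by (simp add: sum.If_cases)
  also have "{1..n} \<inter> J = J" by (auto simp: J_def)
  also have "card J \<le> card {1, 2 :: nat}"
  \<comment> \<open>Stockpiles whose interiors contain \<open>y\<close> overlap, so they lie on
    different pads, and there are only two pads.\<close>
  proof (rule card_inj_on_le[of pad])
    show "inj_on pad J"
    proof (rule inj_onI, rule ccontr)
      fix i j assume ij: "i \<in> J" "j \<in> J" "pad i = pad j" "i \<noteq> j"
      then have "i \<in> {1..n}" "j \<in> {1..n}" by (auto simp: J_def)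
      with ij have "l i + real_of_int (p i) \<le> l j \<or> l j + real_of_int (p j) \<le> l i"
        using assms(2) unfolding valid_placement_def by blast
      then show False using ij by (auto simp: J_def)
    qed
    show "pad ` J \<subseteq> {1, 2}" using assms(2) by (auto simp: valid_placement_def J_def)
  qed simp
  finally show ?thesis by simp
qed

lemma affine_pieceD: "affine_piece H a b \<sigma> \<Longrightarrow> v \<in> {a..b} \<Longrightarrow> H v = H a + \<sigma> * (v - a)"
  unfolding affine_piece_def by blast

text \<open>Each piece has slope at most \<open>s\<close> in absolute value, and the triangle
  inequality at \<open>t i\<close> joins the pieces. This bounds the distance covered in a given
  time.\<close>

lemma piecewise_affine_lipschitz:
  assumes "breakpoints C m t" "\<And>i. i < m \<Longrightarrow> affine_piece H (t i) (t (Suc i)) (\<sigma> i)"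
    and "\<And>i. i < m \<Longrightarrow> \<bar>\<sigma> i\<bar> \<le> s" and "0 \<le> u" "u \<le> v" "v \<le> C"
  shows "\<bar>H v - H u\<bar> \<le> s * (v - u)"
proof -
  have "\<bar>H v - H u\<bar> \<le> s * (v - u)" if "i \<le> m" "0 \<le> u" "u \<le> v" "v \<le> t i" for i u v
    using that
  proof (induction i arbitrary: u v)
    case 0
    then have "u = v" using assms(1) by (auto simp: breakpoints_def)
    then show ?case by simp
  next
    case (Suc i)
    have piece: "\<bar>H v' - H u'\<bar> \<le> s * (v' - u')" if "t i \<le> u'" "u' \<le> v'" "v' \<le> t (Suc i)" for u' v'
    proof -
      have "H v' = H (t i) + \<sigma> i * (v' - t i)" "H u' = H (t i) + \<sigma> i * (u' - t i)"
        using affine_pieceD[OF assms(2)[of i], of v'] affine_pieceD[OF assms(2)[of i], of u']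
          Suc.prems(1) that by auto
      then have "H v' - H u' = \<sigma> i * (v' - u')" by (simp add: algebra_simps)
      then have "\<bar>H v' - H u'\<bar> = \<bar>\<sigma> i\<bar> * (v' - u')" using that by (simp add: abs_mult)
      also have "\<dots> \<le> s * (v' - u')"
        using assms(3)[of i] Suc.prems that by (intro mult_right_mono) auto
      finally show ?thesis .
    qed
    consider "v \<le> t i" | "t i \<le> u" | "u < t i" "t i < v" by linarith
    then show ?case
    proof cases
      case 3
      have "\<bar>H v - H (t i)\<bar> \<le> s * (v - t i)" using piece[of "t i" v] Suc.prems 3 by simp
      moreover have "\<bar>H (t i) - H u\<bar> \<le> s * (t i - u)" using Suc.IH[of u "t i"] Suc.prems 3 by simp
      ultimately show ?thesis by (simp add: algebra_simps)
    qed (use Suc piece in auto)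
  qed
  from this[of m u v] show ?thesis using assms by (simp add: breakpoints_def)
qed

text \<open>Observed at the starts and ends of the reclaiming windows, a schedule becomes a walk.
  Its length is at most \<open>P + s * (C - P)\<close>, since time \<open>C - P\<close> remains for
  travel; \<open>walk_length_bound\<close> bounds the same length from below.\<close>

lemma makespan_lower_bound:
  assumes inst: "reclaimer_instance L s n p" and feas: "feasible_solution L s n p pad l C H"
    and k: "k \<in> {1..n}"
  defines "P \<equiv> (\<Sum>j=1..n. real_of_int (p j))"
  shows "P + (2 * min (\<Sum>j=1..k. real_of_int (p j)) (\<Sum>j=k..n. real_of_int (p j)) - P) / s \<le> C"
proof -
  from feas have placed: "valid_placement L n p pad l" and sched: "valid_schedule L s n p l C H"
    by (auto simp: feasible_solution_def)
  have s: "1 \<le> s" and p: "\<And>j. j \<in> {1..n} \<Longrightarrow> 0 < p j" using inst by (auto simp: reclaimer_instance_def)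
  have HC: "0 \<le> C" "H 0 = 0" "H C = 0" "\<And>u. u \<in> {0..C} \<Longrightarrow> 0 \<le> H u"
    using sched by (simp_all add: valid_schedule_def)
  obtain m t \<sigma> a where bp: "breakpoints C m t"
    and pieces: "\<forall>i<m. \<sigma> i \<in> {0, s, - s, 1, - 1} \<and> affine_piece H (t i) (t (Suc i)) (\<sigma> i)"
    and windows: "\<forall>j\<in>{1..n}. 0 \<le> a j \<and> a j + of_int (p j) \<le> C \<and>
           traverses H (a j) (l j) (of_int (p j))"
    and order: "\<forall>j\<in>{1..<n}. a j + of_int (p j) \<le> a (Suc j)"
    using sched unfolding valid_schedule_def by (elim conjE exE) (rule that; assumption)
  note a = bspec[OF windows] and ord = bspec[OF order]
  have \<sigma>: "\<sigma> i \<in> {0, s, - s, 1, - 1}" and piece: "affine_piece H (t i) (t (Suc i)) (\<sigma> i)"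
    if "i < m" for i using pieces that by simp_all
  \<comment> \<open>Observation times: \<open>2 * j - 1\<close> indexes the start and
    \<open>2 * j\<close> the end of reclaiming \<open>j\<close>; \<open>0\<close> and
    \<open>2 * n + 1\<close> index the ends of the schedule.\<close>
  define \<tau> where "\<tau> i = (if i = 0 then 0 else if i = 2 * n + 1 then C
    else if odd i then a (Suc i div 2) else a (i div 2) + of_int (p (i div 2)))" for i
  define z where "z i = H (\<tau> i)" for i
  have \<tau>_odd: "\<tau> (2 * j - 1) = a j" and \<tau>_even: "\<tau> (2 * j) = a j + of_int (p j)" if "j \<in> {1..n}" for j
    using that by (auto simp: \<tau>_def)
  have \<tau>_ends: "\<tau> 0 = 0" "\<tau> (2 * n + 1) = C" by (auto simp: \<tau>_def)
  have \<tau>_range: "0 \<le> \<tau> i \<and> \<tau> i \<le> C" if "i \<le> 2 * n + 1" for i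
  proof -
    consider "i = 0" | "i = 2 * n + 1" | j where "j \<in> {1..n}" "i = 2 * j" | j where "j \<in> {1..n}" "i = 2 * j - 1"
    proof (cases "even i")
      case True
      then obtain j where "i = 2 * j" by blast
      then show ?thesis using that(1) that(3)[of j] \<open>i \<le> 2 * n + 1\<close> by (cases "j = 0") auto
    next
      case False
      then obtain j where "i = 2 * j + 1" by (blast elim: oddE)
      then show ?thesis using that(2) that(4)[of "Suc j"] \<open>i \<le> 2 * n + 1\<close> by (cases "j = n") auto
    qed
    then show ?thesis
    proof cases
      case (3 j)
      then show ?thesis using a[OF 3(1)] p[OF 3(1)] \<tau>_even[OF 3(1)] by simp
    next
      case (4 j)
      then show ?thesis using a[OF 4(1)] p[OF 4(1)] \<tau>_odd[OF 4(1)] by simp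
    qed (use \<tau>_ends HC in auto)
  qed
  have z_ends: "z 0 = 0" "z (2 * n + 1) = 0" using \<tau>_ends HC by (auto simp: z_def)
  have z_nonneg: "0 \<le> z i" if "i \<le> 2 * n + 1" for i
    using \<tau>_range[OF that] HC by (simp add: z_def)
  have ends: "z (2 * j - 1) = l j \<and> z (2 * j) = l j + real_of_int (p j) \<or>
      z (2 * j - 1) = l j + real_of_int (p j) \<and> z (2 * j) = l j" if j: "j \<in> {1..n}" for j
  proof -
    have "0 \<in> {0..real_of_int (p j)}" "real_of_int (p j) \<in> {0..real_of_int (p j)}"
      using p[OF j] by auto
    moreover have "(\<forall>u\<in>{0..real_of_int (p j)}. H (a j + u) = l j + u) \<or>
        (\<forall>u\<in>{0..real_of_int (p j)}. H (a j + u) = l j + real_of_int (p j) - u)"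
      using a[OF j] by (simp add: traverses_def)
    ultimately show ?thesis unfolding z_def \<tau>_odd[OF j] \<tau>_even[OF j] by fastforce
  qed
  have q: "\<bar>z (2 * j) - z (2 * j - 1)\<bar> = real_of_int (p j)" if "j \<in> {1..n}" for j
    using ends[OF that] p[OF that] by auto
  \<comment> \<open>Because \<open>1 \<le> s\<close>, the reclaiming slopes stay within speed
    \<open>s\<close> as well.\<close>
  have lip: "\<bar>H v - H u\<bar> \<le> s * (v - u)" if "0 \<le> u" "u \<le> v" "v \<le> C" for u v
  proof (rule piecewise_affine_lipschitz[OF bp piece _ that])
    show "\<bar>\<sigma> i\<bar> \<le> s" if "i < m" for i using \<sigma>[OF that] s by auto
  qed
  have gap: "\<tau> (2 * j) \<le> \<tau> (Suc (2 * j))" if "j \<le> n" for j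
  proof (cases "j = 0 \<or> j = n")
    case True
    then show ?thesis using \<tau>_range[of "2 * j"] \<tau>_range[of "Suc (2 * j)"] \<tau>_ends that by auto
  next
    case False
    then show ?thesis using that ord[of j] \<tau>_even[of j] \<tau>_odd[of "Suc j"] by simp
  qed
  \<comment> \<open>The time differences telescope to \<open>C\<close>; the odd ones are reclaiming
    times with sum \<open>P\<close>, which leaves \<open>C - P\<close> for travel.\<close>
  have "(\<Sum>i=0..<2 * n + 1. \<tau> (Suc i) - \<tau> i) = C"
    using \<tau>_ends by (simp add: sum_Suc_diff')
  then have "(\<Sum>j=1..n. \<tau> (Suc (2 * j - 1)) - \<tau> (2 * j - 1)) + (\<Sum>j=0..n. \<tau> (Suc (2 * j)) - \<tau> (2 * j)) = C"
    by (simp only: sum_even_odd)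
  moreover have "(\<Sum>j=1..n. \<tau> (Suc (2 * j - 1)) - \<tau> (2 * j - 1)) = P"
    unfolding P_def
  proof (rule sum.cong)
    fix j assume j: "j \<in> {1..n}"
    then have "Suc (2 * j - 1) = 2 * j" by auto
    then show "\<tau> (Suc (2 * j - 1)) - \<tau> (2 * j - 1) = real_of_int (p j)"
      using \<tau>_odd[OF j] \<tau>_even[OF j] by simp
  qed simp
  ultimately have travel_time: "(\<Sum>j=0..n. \<tau> (Suc (2 * j)) - \<tau> (2 * j)) = C - P" by linarith
  have "(\<Sum>j=0..n. \<bar>z (Suc (2 * j)) - z (2 * j)\<bar>) \<le> (\<Sum>j=0..n. s * (\<tau> (Suc (2 * j)) - \<tau> (2 * j)))"
    unfolding z_def using gap \<tau>_range by (intro sum_mono lip) auto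
  then have travel: "(\<Sum>j=0..n. \<bar>z (Suc (2 * j)) - z (2 * j)\<bar>) \<le> s * (C - P)"
    by (simp only: sum_distrib_left[symmetric] travel_time)
  have reclaim: "(\<Sum>j=1..n. \<bar>z (Suc (2 * j - 1)) - z (2 * j - 1)\<bar>) = P"
    unfolding P_def
  proof (rule sum.cong)
    fix j assume j: "j \<in> {1..n}"
    then have "Suc (2 * j - 1) = 2 * j" by auto
    then show "\<bar>z (Suc (2 * j - 1)) - z (2 * j - 1)\<bar> = real_of_int (p j)"
      using q[OF j] by simp
  qed simp
  have total: "(\<Sum>i=0..<2 * n + 1. \<bar>z (Suc i) - z i\<bar>) \<le> P + s * (C - P)"
    unfolding sum_even_odd using travel reclaim by linarith
  have "2 * min (\<Sum>j=1..k. \<bar>z (2 * j) - z (2 * j - 1)\<bar>) (\<Sum>j=k..n. \<bar>z (2 * j) - z (2 * j - 1)\<bar>)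
      \<le> (\<Sum>i=0..<2 * n + 1. \<bar>z (Suc i) - z i\<bar>)"
  proof (rule walk_length_bound[OF z_ends z_nonneg _ k])
    show "(\<Sum>j=1..n. cross (z (2 * j - 1)) (z (2 * j)) y) \<le> 2" for y
      using interval_count_le_2[OF p placed ends] .
  qed
  moreover have "(\<Sum>j=1..k. \<bar>z (2 * j) - z (2 * j - 1)\<bar>) = (\<Sum>j=1..k. real_of_int (p j))"
    "(\<Sum>j=k..n. \<bar>z (2 * j) - z (2 * j - 1)\<bar>) = (\<Sum>j=k..n. real_of_int (p j))"
    using k q by (auto intro!: sum.cong)
  ultimately have "2 * min (\<Sum>j=1..k. real_of_int (p j)) (\<Sum>j=k..n. real_of_int (p j)) - P \<le> s * (C - P)"
    using total by linarith
  then have "(2 * min (\<Sum>j=1..k. real_of_int (p j)) (\<Sum>j=k..n. real_of_int (p j)) - P) / s \<le> C - P"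
    using s by (simp add: divide_le_eq mult.commute)
  then show ?thesis by linarith
qed

section \<open>Schedules from walks\<close>

text \<open>Supplies the schedule for a given list of breakpoints. A new piece is attached to the
  right of \<open>t m\<close>, where both formulas give \<open>x m\<close>.\<close>

lemma piecewise_linear_interpolation:
  assumes "\<And>i. i < m \<Longrightarrow> t i < t (Suc i)"
  shows "\<exists>H. (\<forall>i\<le>m. H (t i) = x i) \<and>
     (\<forall>i<m. affine_piece H (t i) (t (Suc i)) ((x (Suc i) - x i) / (t (Suc i) - t i)))"
  using assms
proof (induction m)
  case 0
  show ?case by (rule exI[of _ "\<lambda>_. x 0"]) simp
next
  case (Suc m)
  then obtain H where H: "\<And>i. i \<le> m \<Longrightarrow> H (t i) = x i"
    "\<And>i. i < m \<Longrightarrow> affine_piece H (t i) (t (Suc i)) ((x (Suc i) - x i) / (t (Suc i) - t i))"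
    by auto
  have mono: "t i \<le> t m" if "i \<le> m" for i
    using that
  proof (induction i rule: inc_induct)
    case (step i)
    then show ?case using Suc.prems[of i] by simp
  qed simp
  let ?\<sigma> = "(x (Suc m) - x m) / (t (Suc m) - t m)"
  let ?H = "\<lambda>v. if v \<le> t m then H v else x m + ?\<sigma> * (v - t m)"
  have tm: "t m < t (Suc m)" using Suc.prems by simp
  have "?H (t i) = x i" if "i \<le> Suc m" for i
    using that mono[of i] H(1)[of i] tm by (cases "i = Suc m") auto
  moreover have "affine_piece ?H (t i) (t (Suc i)) ((x (Suc i) - x i) / (t (Suc i) - t i))"
    if "i < Suc m" for i
  proof (cases "i = m")
    case True
    then show ?thesis using H(1)[of m] by (auto simp: affine_piece_def)
  next
    case False
    then have "t i \<le> t m" and "t (Suc i) \<le> t m" using that mono by auto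
    have "i < m" using that False by simp
    show ?thesis
      unfolding affine_piece_def
    proof
      fix v assume v: "v \<in> {t i..t (Suc i)}"
      then have "v \<le> t m" using \<open>t (Suc i) \<le> t m\<close> by simp
      then show "?H v = ?H (t i) + (x (Suc i) - x i) / (t (Suc i) - t i) * (v - t i)"
        using affine_pieceD[OF H(2)[OF \<open>i < m\<close>] v] \<open>t i \<le> t m\<close> by simp
    qed
  qed
  ultimately show ?case by (intro exI[of _ ?H]) simp
qed

lemma breakpoints_cover:
  assumes "u \<in> {t 0..t m}" "0 < m"
  obtains i where "i < m" "u \<in> {t i..t (Suc i :: nat) :: real}"
proof -
  have "\<exists>i<m. u \<in> {t i..t (Suc i)}"
    using assms
  proof (induction m)
    case (Suc m)
    show ?case
    proof (cases "m = 0 \<or> t m \<le> u")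
      case True
      then show ?thesis using Suc.prems by (intro exI[of _ m]) auto
    next
      case False
      then obtain i where "i < m" "u \<in> {t i..t (Suc i)}" using Suc by auto
      then show ?thesis by (intro exI[of _ i]) auto
    qed
  qed simp
  then show thesis using that by blast
qed

text \<open>Stockpile \<open>j\<close> has length \<open>q j\<close>; its reclaiming starts at
  position \<open>u j\<close> and ends at \<open>w j\<close>, so their order encodes the
  direction.\<close>

locale stockpile_walk =
  fixes L s :: real and n :: nat and q u w :: "nat \<Rightarrow> real"
  assumes s: "1 \<le> s"
    and q_pos: "\<And>j. j \<in> {1..n} \<Longrightarrow> 0 < q j"
    and q_eq: "\<And>j. j \<in> {1..n} \<Longrightarrow> \<bar>w j - u j\<bar> = q j"
    and range: "\<And>j. j \<in> {1..n} \<Longrightarrow> u j \<in> {0..L} \<and> w j \<in> {0..L}" "0 \<le> L"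
begin

text \<open>The polygonal path through \<open>(t i, x i)\<close>, \<open>i = 0, \<dots>, m\<close>, reclaims the stockpiles
  \<open>1, \<dots>, j\<close>, stockpile \<open>i\<close> on the segment with index \<open>f i\<close>, and travels on all other segments.\<close>

definition walk_prefix ::
  "nat \<Rightarrow> nat \<Rightarrow> (nat \<Rightarrow> real) \<Rightarrow> (nat \<Rightarrow> real) \<Rightarrow> (nat \<Rightarrow> nat) \<Rightarrow> bool" where
  "walk_prefix j m t x f \<longleftrightarrow>
     t 0 = 0 \<and> x 0 = 0 \<and> (\<forall>i<m. t i < t (Suc i)) \<and> (\<forall>i\<le>m. x i \<in> {0..L}) \<and>
     (\<forall>i<m. \<bar>x (Suc i) - x i\<bar> = s * (t (Suc i) - t i) \<or> i \<in> f ` {1..j}) \<and>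
     (\<forall>i\<in>{1..j}. f i < m \<and> x (f i) = u i \<and> x (Suc (f i)) = w i \<and>
        t (Suc (f i)) = t (f i) + q i) \<and>
     (\<forall>i\<in>{1..<j}. f i < f (Suc i))"

lemma walk_prefix_0: "t 0 = 0 \<Longrightarrow> x 0 = 0 \<Longrightarrow> walk_prefix 0 0 t x f"
  using range(2) by (simp add: walk_prefix_def)

text \<open>The condition \<open>v \<noteq> x m\<close> keeps the breakpoint times strictly
  increasing.\<close>

lemma walk_prefix_travel:
  assumes "walk_prefix j m t x f" "v \<in> {0..L}" "v \<noteq> x m"
  shows "walk_prefix j (Suc m) (t(Suc m := t m + \<bar>v - x m\<bar> / s)) (x(Suc m := v)) f"
  using assms s unfolding walk_prefix_def
  by (auto simp: less_Suc_eq le_Suc_eq)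

lemma walk_prefix_reclaim:
  assumes "walk_prefix j m t x f" "Suc j \<le> n" "x m = u (Suc j)"
  shows "walk_prefix (Suc j) (Suc m) (t(Suc m := t m + q (Suc j))) (x(Suc m := w (Suc j)))
    (f(Suc j := m))"
proof -
  have "Suc j \<in> {1..n}" using assms by auto
  note * = q_pos[OF this] range(1)[OF this]
  let ?t = "t(Suc m := t m + q (Suc j))" and ?x = "x(Suc m := w (Suc j))" and ?f = "f(Suc j := m)"
  have t0: "t 0 = 0" and x0: "x 0 = 0" and inc: "\<And>i. i < m \<Longrightarrow> t i < t (Suc i)"
    and xr: "\<And>i. i \<le> m \<Longrightarrow> x i \<in> {0..L}"
    and trav: "\<And>i. i < m \<Longrightarrow> \<bar>x (Suc i) - x i\<bar> = s * (t (Suc i) - t i) \<or> i \<in> f ` {1..j}"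
    and recl: "\<And>i. i \<in> {1..j} \<Longrightarrow> f i < m \<and> x (f i) = u i \<and> x (Suc (f i)) = w i \<and>
        t (Suc (f i)) = t (f i) + q i"
    and ord: "\<And>i. i \<in> {1..<j} \<Longrightarrow> f i < f (Suc i)"
    using assms(1) unfolding walk_prefix_def by blast+
  have img: "?f ` {1..Suc j} = insert m (f ` {1..j})"
    by (auto simp: atLeastAtMostSuc_conv image_iff)
  have "?f i < Suc m \<and> ?x (?f i) = u i \<and> ?x (Suc (?f i)) = w i \<and>
        ?t (Suc (?f i)) = ?t (?f i) + q i" if "i \<in> {1..Suc j}" for i
    using that recl[of i] assms(3) by (cases "i = Suc j") auto
  moreover have "?f i < ?f (Suc i)" if "i \<in> {1..<Suc j}" for i
    using that recl[of i] ord[of i] by (cases "i = j") auto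
  moreover have "?t i < ?t (Suc i)" if "i < Suc m" for i
    using that inc[of i] * by (cases "i = m") auto
  moreover have "?x i \<in> {0..L}" if "i \<le> Suc m" for i
    using that xr[of i] * by (cases "i = Suc m") auto
  moreover have "\<bar>?x (Suc i) - ?x i\<bar> = s * (?t (Suc i) - ?t i) \<or> i \<in> ?f ` {1..Suc j}"
    if "i < Suc m" for i
    using that trav[of i] unfolding img by (cases "i = m") auto
  ultimately show ?thesis using t0 x0 unfolding walk_prefix_def by simp
qed

text \<open>The window of \<open>j\<close> starts at \<open>t (f j)\<close>, and the windows are
  ordered because \<open>f\<close> is increasing. Reclaiming segments have slope \<open>1\<close> or
  \<open>- 1\<close>, since length and duration agree; all others have slope \<open>s\<close> or
  \<open>- s\<close>.\<close>

lemma walk_prefix_schedule: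
  fixes L' :: int and p :: "nat \<Rightarrow> int"
  assumes walk: "walk_prefix n m t x f" and end0: "x m = 0"
    and p: "\<And>j. j \<in> {1..n} \<Longrightarrow> q j = real_of_int (p j)" and L: "L = real_of_int L'"
    and l: "\<And>j. j \<in> {1..n} \<Longrightarrow> l j = min (u j) (w j)"
  shows "breakpoints (t m) m t \<and>
    (\<exists>H. interpolates m t x H \<and> valid_schedule L' s n p l (t m) H)"
proof
  have t0: "t 0 = 0" and x0: "x 0 = 0" and inc: "\<And>i. i < m \<Longrightarrow> t i < t (Suc i)"
    and xr: "\<And>i. i \<le> m \<Longrightarrow> x i \<in> {0..L}"
    and trav: "\<And>i. i < m \<Longrightarrow> \<bar>x (Suc i) - x i\<bar> = s * (t (Suc i) - t i) \<or> i \<in> f ` {1..n}"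
    and recl: "\<And>i. i \<in> {1..n} \<Longrightarrow> f i < m \<and> x (f i) = u i \<and> x (Suc (f i)) = w i \<and>
        t (Suc (f i)) = t (f i) + q i"
    and ord: "\<And>i. i \<in> {1..<n} \<Longrightarrow> f i < f (Suc i)"
    using walk unfolding walk_prefix_def by blast+
  show bp: "breakpoints (t m) m t" using t0 inc by (simp add: breakpoints_def)
  have mono: "t i \<le> t i'" if "i \<le> i'" "i' \<le> m" for i i'
    using that
  proof (induction i rule: inc_induct)
    case (step i)
    then show ?case using inc[of i] by simp
  qed simp
  let ?\<sigma> = "\<lambda>i. (x (Suc i) - x i) / (t (Suc i) - t i)"
  obtain H where H: "\<And>i. i \<le> m \<Longrightarrow> H (t i) = x i"
    and piece: "\<And>i. i < m \<Longrightarrow> affine_piece H (t i) (t (Suc i)) (?\<sigma> i)"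
    using piecewise_linear_interpolation[of m t x] inc by blast
  have recl_slope: "?\<sigma> (f j) = (if u j \<le> w j then 1 else - 1)" if "j \<in> {1..n}" for j
    using recl[OF that] q_eq[OF that] q_pos[OF that] by (auto simp: field_simps)
  have slope: "?\<sigma> i \<in> {s, - s} \<or> i \<in> f ` {1..n}" if "i < m" for i
    using trav[OF that] inc[OF that] by (auto simp: abs_if field_simps split: if_splits)
  have trv: "traverses H (t (f j)) (l j) (of_int (p j))" if j: "j \<in> {1..n}" for j
  proof -
    note r = recl[OF j]
    have eq: "H (t (f j) + v) = u j + ?\<sigma> (f j) * v" if "v \<in> {0..q j}" for v
      using affine_pieceD[OF piece[of "f j"], of "t (f j) + v"] H[of "f j"] r that by simp
    show ?thesis
    proof (cases "u j \<le> w j")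
      case True
      then show ?thesis using eq l[OF j] p[OF j] recl_slope[OF j] by (simp add: traverses_def)
    next
      case False
      then have "u j = l j + q j" using q_eq[OF j] l[OF j] by simp
      then show ?thesis using False eq l[OF j] p[OF j] recl_slope[OF j] by (simp add: traverses_def)
    qed
  qed
  have range_H: "0 \<le> H v \<and> H v \<le> L" if v: "v \<in> {0..t m}" for v
  proof (cases "m = 0")
    case True
    then show ?thesis using v t0 H[of 0] x0 range(2) by simp
  next
    case False
    then obtain i where i: "i < m" "v \<in> {t i..t (Suc i)}"
      using breakpoints_cover[of v t m] v t0 by auto
    \<comment> \<open>The fraction of the segment completed at time \<open>v\<close>; it makes
      \<open>H v\<close> a convex combination of two values in \<open>[0, L]\<close>.\<close>
    define c where "c = (v - t i) / (t (Suc i) - t i)"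
    have c: "0 \<le> c" "c \<le> 1" using i inc[OF i(1)] by (auto simp: c_def)
    have "H v = x i + ?\<sigma> i * (v - t i)"
      using affine_pieceD[OF piece[OF i(1)] i(2)] H[of i] i(1) by simp
    also have "?\<sigma> i * (v - t i) = c * (x (Suc i) - x i)" by (simp add: c_def)
    finally have Hv: "H v = (1 - c) * x i + c * x (Suc i)"
      by (simp add: algebra_simps)
    have "x i \<in> {0..L}" "x (Suc i) \<in> {0..L}" using xr i(1) by auto
    then show ?thesis
      using c convex_bound_le[of "x i" L "x (Suc i)" "1 - c" c] unfolding Hv by auto
  qed
  show "\<exists>H. interpolates m t x H \<and> valid_schedule L' s n p l (t m) H"
  proof (intro exI conjI)
    show "interpolates m t x H" using H piece by (auto simp: interpolates_def)
    show "valid_schedule L' s n p l (t m) H"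
      unfolding valid_schedule_def
    proof (intro conjI exI)
      show "0 \<le> t m" using mono[of 0 m] t0 by simp
      show "H 0 = 0" using H[of 0] t0 x0 by simp
      show "H (t m) = 0" using H[of m] end0 by simp
      show "\<forall>v\<in>{0..t m}. 0 \<le> H v \<and> H v \<le> of_int L'" using range_H L by simp
      show "breakpoints (t m) m t" by fact
      show "\<forall>i<m. ?\<sigma> i \<in> {0, s, - s, 1, - 1} \<and> affine_piece H (t i) (t (Suc i)) (?\<sigma> i)"
      proof (intro allI impI conjI)
        fix i assume i: "i < m"
        show "affine_piece H (t i) (t (Suc i)) (?\<sigma> i)" using piece[OF i] .
        show "?\<sigma> i \<in> {0, s, - s, 1, - 1}" using slope[OF i]
        proof
          assume "i \<in> f ` {1..n}"
          then obtain j where "j \<in> {1..n}" "i = f j" by blast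
          then show ?thesis using recl_slope[of j] by simp
        qed auto
      qed
      show "\<forall>j\<in>{1..n}. 0 \<le> t (f j) \<and> t (f j) + real_of_int (p j) \<le> t m \<and>
          traverses H (t (f j)) (l j) (real_of_int (p j))"
      proof
        fix j assume j: "j \<in> {1..n}"
        show "0 \<le> t (f j) \<and> t (f j) + real_of_int (p j) \<le> t m \<and>
          traverses H (t (f j)) (l j) (real_of_int (p j))"
          using trv[OF j] recl[OF j] p[OF j] mono[of 0 "f j"] mono[of "Suc (f j)" m] t0 by simp
      qed
      show "\<forall>j\<in>{1..<n}. t (f j) + real_of_int (p j) \<le> t (f (Suc j))"
      proof
        fix j assume j: "j \<in> {1..<n}"
        then have j': "j \<in> {1..n}" "Suc j \<in> {1..n}" by auto
        show "t (f j) + real_of_int (p j) \<le> t (f (Suc j))"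
          using recl[OF j'(1)] recl[OF j'(2)] p[OF j'(1)] ord[OF j]
            mono[of "Suc (f j)" "f (Suc j)"] by simp
      qed
      show "\<forall>i<m. ?\<sigma> i \<notin> {0, s, - s} \<longrightarrow>
           (\<exists>j\<in>{1..n}. {t i..t (Suc i)} \<subseteq> {t (f j)..t (f j) + of_int (p j)})"
      proof (intro allI impI)
        fix i assume "i < m" "?\<sigma> i \<notin> {0, s, - s}"
        then obtain j where "j \<in> {1..n}" "i = f j" using slope by blast
        then show "\<exists>j\<in>{1..n}. {t i..t (Suc i)} \<subseteq> {t (f j)..t (f j) + of_int (p j)}"
          using recl[of j] p[of j] by (intro bexI[of _ j]) auto
      qed
    qed
  qed
qed

end

section \<open>The optimal layout\<close>

text \<open>Stockpiles \<open>1, \<dots>, k - 1\<close> lie side by side and are reclaimed from left to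
  right, starting at \<open>y0\<close>; stockpile \<open>k\<close> is reclaimed from \<open>xs\<close> to \<open>xe\<close>; stockpiles
  \<open>k + 1, \<dots>, n\<close> are reclaimed from right to left, ending at \<open>y1\<close>.\<close>

locale layout =
  fixes L s :: real and n :: nat and q :: "nat \<Rightarrow> real" and k :: nat
    and y0 y1 xs xe :: real and qk qs :: nat
  assumes s: "1 \<le> s"
    and q_nonneg: "\<And>j. 0 \<le> q j"
    and q_pos: "\<And>j. j \<in> {1..n} \<Longrightarrow> 0 < q j"
    and q_outside: "\<And>j. j \<notin> {1..n} \<Longrightarrow> q j = 0"
    and k: "1 \<le> k" "1 \<le> n \<Longrightarrow> k \<le> n"
    and prefix_fits: "0 \<le> y0" "y0 + (\<Sum>i=1..k-1. q i) \<le> L"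
    and suffix_fits: "0 \<le> y1" "y1 + (\<Sum>i=k+1..n. q i) \<le> L"
    and mid_fits: "0 \<le> xs" "xs \<le> L" "0 \<le> xe" "xe \<le> L" "\<bar>xe - xs\<bar> = q k"
    and pads: "qk \<in> {1, 2}" "qs \<in> {1, 2}"
    and prefix_mid: "qk = 1 \<Longrightarrow> y0 + (\<Sum>i=1..k-1. q i) \<le> min xs xe"
    and prefix_suffix: "qs = 1 \<Longrightarrow>
      y0 + (\<Sum>i=1..k-1. q i) \<le> y1 \<or> y1 + (\<Sum>i=k+1..n. q i) \<le> y0"
    and mid_suffix: "qk = qs \<Longrightarrow> y1 + (\<Sum>i=k+1..n. q i) \<le> min xs xe"
    and short: "y0 + \<bar>xs - (y0 + (\<Sum>i=1..k-1. q i))\<bar> + \<bar>xe - (y1 + (\<Sum>i=k+1..n. q i))\<bar> + y1 \<le>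
      2 * min (\<Sum>i=1..k. q i) (\<Sum>i=k..n. q i) - (\<Sum>i=1..n. q i)"
begin

definition S :: "nat \<Rightarrow> real" where "S j = (\<Sum>i=1..j. q i)"

text \<open>For \<open>k < j\<close>, the term \<open>S n - S j\<close> is the total length of the
  stockpiles after \<open>j\<close>, which lie to the left of \<open>j\<close>.\<close>

definition u :: "nat \<Rightarrow> real" where
  "u j = (if j < k then y0 + S (j - 1) else if k < j then y1 + (S n - S j) + q j else xs)"

text \<open>The value \<open>w 0 = 0\<close> stands for the starting point of the reclaimer, so that
  the journey before stockpile \<open>j\<close> always leads from \<open>w (j - 1)\<close> to
  \<open>u j\<close>.\<close>

definition w :: "nat \<Rightarrow> real" where
  "w j = (if j = 0 then 0 else if j < k then y0 + S j else if k < j then y1 + (S n - S j) else xe)"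

definition pad :: "nat \<Rightarrow> nat" where
  "pad j = (if j < k then 1 else if k < j then qs else qk)"

definition travel :: "nat \<Rightarrow> real" where
  "travel j = (\<Sum>i=1..j. \<bar>u i - w (i - 1)\<bar>)"

section \<open>Partial sums and disjointness of the stockpiles\<close>

lemma S_0 [simp]: "S 0 = 0" by (simp add: S_def)

lemma S_Suc [simp]: "S (Suc j) = S j + q (Suc j)" by (simp add: S_def)

lemma S_minus: "1 \<le> j \<Longrightarrow> S j = S (j - 1) + q j" by (cases j) auto

lemma S_mono: "i \<le> j \<Longrightarrow> S i \<le> S j"
  unfolding S_def using q_nonneg by (intro sum_mono2) auto

lemma S_nonneg: "0 \<le> S j"
  using S_mono[of 0 j] by simp

text \<open>For \<open>n < j\<close> both sides vanish by \<open>q_outside\<close>; this occurs for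
  \<open>n = 0\<close>, where \<open>k\<close> exceeds \<open>n\<close>.\<close>

lemma sum_tail: "(\<Sum>i=j+1..n. q i) = S n - S j"
proof (cases "j \<le> n")
  case True
  then have "{1..n} = {1..j} \<union> {j+1..n}" by auto
  then have "S n = S j + (\<Sum>i=j+1..n. q i)"
    unfolding S_def by (subst sum.union_disjoint[symmetric]) auto
  then show ?thesis by simp
next
  case False
  then have "(\<Sum>i=n+1..j. q i) = 0" using q_outside by (intro sum.neutral) auto
  moreover have "{1..j} = {1..n} \<union> {n+1..j}" using False by auto
  then have "S j = S n + (\<Sum>i=n+1..j. q i)"
    unfolding S_def by (subst sum.union_disjoint[symmetric]) auto
  ultimately show ?thesis using False by simp
qed

lemma sum_prefix: "(\<Sum>i=1..k-1. q i) = S (k - 1)"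
  by (simp add: S_def)

lemma ends_cases:
  assumes "j \<in> {1..n}"
  obtains "j < k" "min (u j) (w j) = y0 + S (j - 1)" "u j = y0 + S (j - 1)" "w j = y0 + S j" "pad j = 1"
      "S (j - 1) + q j = S j" "S j \<le> S (k - 1)"
    | "j = k" "u j = xs" "w j = xe" "pad j = qk"
    | "k < j" "min (u j) (w j) = y1 + (S n - S j)" "u j = y1 + (S n - S j) + q j" "w j = y1 + (S n - S j)"
      "pad j = qs" "S (j - 1) + q j = S j" "S k \<le> S (j - 1)" "S j \<le> S n"
proof -
  have S: "S (j - 1) + q j = S j" using S_minus[of j] assms by simp
  have "S j \<le> S (k - 1)" if "j < k" using that by (intro S_mono) auto
  moreover have "S k \<le> S (j - 1)" if "k < j" using that by (intro S_mono) auto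
  moreover have "S j \<le> S n" using assms by (intro S_mono) auto
  ultimately show thesis using that S q_pos[OF assms] assms k
    by (cases j k rule: linorder_cases) (auto simp: u_def w_def pad_def min_def)
qed

lemma stockpile_walk: "stockpile_walk L s n q u w"
proof
  show "\<bar>w j - u j\<bar> = q j" if "j \<in> {1..n}" for j
    using that q_pos[OF that] mid_fits(5) by (cases rule: ends_cases[OF that]) auto
  show "u j \<in> {0..L} \<and> w j \<in> {0..L}" if "j \<in> {1..n}" for j
    using prefix_fits suffix_fits mid_fits S_nonneg[of "j - 1"] q_pos[OF that] unfolding sum_tail sum_prefix
    by (cases rule: ends_cases[OF that]) auto
  show "0 \<le> L" using mid_fits by linarith
qed (use s q_pos in auto)

sublocale stockpile_walk L s n q u w
  by (rule stockpile_walk)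

text \<open>Within the prefix or the suffix, monotonicity of \<open>S\<close> separates the
  stockpiles. Across blocks, \<open>prefix_mid\<close>, \<open>prefix_suffix\<close> and
  \<open>mid_suffix\<close> apply, as the prefix is on pad 1.\<close>

lemma stockpiles_disjoint:
  assumes i: "i \<in> {1..n}" and j: "j \<in> {1..n}" and "i < j" "pad i = pad j"
  shows "min (u i) (w i) + q i \<le> min (u j) (w j) \<or> min (u j) (w j) + q j \<le> min (u i) (w i)"
proof (cases rule: ends_cases[OF i])
  case 1
  note i1 = 1
  show ?thesis
  proof (cases rule: ends_cases[OF j])
    case 1
    have "S i \<le> S (j - 1)" using \<open>i < j\<close> by (intro S_mono) auto
    then show ?thesis using 1 i1 by linarith
  next
    case 2
    then show ?thesis using i1 prefix_mid assms(4) unfolding sum_prefix by auto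
  next
    case 3
    then show ?thesis using i1 prefix_suffix assms(4) S_nonneg[of "i - 1"] q_pos[OF j] unfolding sum_prefix sum_tail by auto
  qed
next
  case 2
  then show ?thesis
    using \<open>i < j\<close> mid_suffix assms(4) q_pos[OF j] unfolding sum_tail
    by (cases rule: ends_cases[OF j]) auto
next
  case 3
  note i1 = 3
  have "S i \<le> S (j - 1)" using \<open>i < j\<close> by (intro S_mono) auto
  then show ?thesis using i1 \<open>i < j\<close> by (cases rule: ends_cases[OF j]) auto
qed

lemma valid_placement:
  fixes L' :: int and p :: "nat \<Rightarrow> int"
  assumes p: "\<And>j. j \<in> {1..n} \<Longrightarrow> q j = real_of_int (p j)" and L: "L = real_of_int L'"
    and pd: "\<And>j. j \<in> {1..n} \<Longrightarrow> pd j = pad j"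
    and l: "\<And>j. j \<in> {1..n} \<Longrightarrow> l j = min (u j) (w j)"
  shows "valid_placement L' n p pd l"
proof -
  have "pd j \<in> {1, 2} \<and> 0 \<le> l j \<and> l j + of_int (p j) \<le> of_int L'" if j: "j \<in> {1..n}" for j
  proof -
    have "max (u j) (w j) = l j + real_of_int (p j)"
      using q_eq[OF j] l[OF j] p[OF j] by (auto simp: min_def max_def)
    then show ?thesis using range(1)[OF j] pads l[OF j] pd[OF j] L by (auto simp: pad_def)
  qed
  moreover have "l i + of_int (p i) \<le> l j \<or> l j + of_int (p j) \<le> l i"
    if "i \<in> {1..n}" "j \<in> {1..n}" "i \<noteq> j \<and> pd i = pd j" for i j
    using stockpiles_disjoint[of i j] stockpiles_disjoint[of j i] that p l pd
    by (cases i j rule: linorder_cases) auto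
  ultimately show ?thesis unfolding valid_placement_def by blast
qed

section \<open>Travel distance of the layout\<close>

lemma travel_Suc [simp]: "travel (Suc j) = travel j + \<bar>u (Suc j) - w j\<bar>"
  by (simp add: travel_def)

text \<open>The absolute value is the pending journey from 0 to \<open>y0\<close> if
  \<open>j = 0\<close>. Afterwards it is 0, since consecutive stockpiles of the prefix
  touch.\<close>

lemma travel_prefix: "j < k \<Longrightarrow> travel j + \<bar>w j - (y0 + S j)\<bar> \<le> y0"
proof (induction j)
  case 0
  then show ?case using prefix_fits by (simp add: travel_def w_def)
next
  case (Suc j)
  then show ?case by (simp add: u_def w_def split: if_splits)
qed

text \<open>At \<open>j = k\<close> the absolute value is the pending journey from \<open>xe\<close>
  to the right end of the suffix; for larger \<open>j\<close> it is 0.\<close>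

lemma travel_suffix:
  assumes "k \<le> j" "j \<le> n"
  shows "travel j + \<bar>w j - (y1 + (S n - S j))\<bar>
    \<le> y0 + \<bar>xs - (y0 + S (k - 1))\<bar> + \<bar>xe - (y1 + (S n - S k))\<bar>"
  using assms
proof (induction j rule: dec_induct)
  case base
  have "travel (Suc (k - 1)) = travel (k - 1) + \<bar>u (Suc (k - 1)) - w (k - 1)\<bar>"
    by (rule travel_Suc)
  moreover have "Suc (k - 1) = k" "k - 1 < k" using k by auto
  moreover have "\<bar>xs - w (k - 1)\<bar> \<le> \<bar>xs - (y0 + S (k - 1))\<bar> + \<bar>w (k - 1) - (y0 + S (k - 1))\<bar>"
    by linarith
  ultimately show ?case using travel_prefix[of "k - 1"] k by (simp add: u_def[of k] w_def[of k])
next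
  case (step j)
  have "u (Suc j) = y1 + (S n - S j)" "w (Suc j) = y1 + (S n - S (Suc j))"
    using step.hyps by (auto simp: u_def w_def)
  then show ?case using step by (simp del: S_Suc)
qed

text \<open>The left side is the makespan reached, including the return from \<open>w n\<close>; the
  right side is the lower bound for stockpile \<open>k\<close>. Their comparison comes from
  \<open>short\<close>.\<close>

lemma travel_total:
  assumes "1 \<le> n"
  shows "S n + (travel n + \<bar>w n\<bar>) / s
    \<le> S n + (2 * min (\<Sum>i=1..k. q i) (\<Sum>i=k..n. q i) - S n) / s"
proof -
  have "travel n + \<bar>w n\<bar> \<le> 2 * min (\<Sum>i=1..k. q i) (\<Sum>i=k..n. q i) - S n"
  proof -
    have "\<bar>w n\<bar> \<le> \<bar>w n - y1\<bar> + y1" using suffix_fits(1) by linarith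
    moreover have "S n = (\<Sum>i=1..n. q i)" by (simp add: S_def)
    ultimately show ?thesis
      using travel_suffix[of n] k(2)[OF assms] short unfolding sum_tail sum_prefix by simp
  qed
  then show ?thesis using s by (simp add: divide_right_mono)
qed

end

section \<open>Execution of programs\<close>

primrec while_free :: "com \<Rightarrow> bool" where
  "while_free Skip = True"
| "while_free (IAssign x e) = True"
| "while_free (RAssign x e) = True"
| "while_free (IStore x d e) = True"
| "while_free (RStore x d e) = True"
| "while_free (Seq c d) = (while_free c \<and> while_free d)"
| "while_free (Cond b c d) = (while_free c \<and> while_free d)"
| "while_free (While b c) = False"

text \<open>Meant for loop-free programs; the equation for \<open>While\<close> is a dummy.\<close>

primrec effect :: "com \<Rightarrow> state \<Rightarrow> state" where
  "effect Skip st = st"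
| "effect (IAssign x e) st = st\<lparr>ivar := (ivar st)(x := ival e st)\<rparr>"
| "effect (RAssign x e) st = st\<lparr>rvar := (rvar st)(x := rval e st)\<rparr>"
| "effect (IStore x d e) st = st\<lparr>iarr := (iarr st)(x := (iarr st x)(ival d st := ival e st))\<rparr>"
| "effect (RStore x d e) st = st\<lparr>rarr := (rarr st)(x := (rarr st x)(ival d st := rval e st))\<rparr>"
| "effect (Seq c d) st = effect d (effect c st)"
| "effect (Cond b c d) st = (if bval b st then effect c st else effect d st)"
| "effect (While b c) st = st"

text \<open>Charging a conditional for both branches makes the bound independent of the
  state.\<close>

primrec cost :: "com \<Rightarrow> nat" where
  "cost Skip = 1"
| "cost (IAssign x e) = 1 + icost e"
| "cost (RAssign x e) = 1 + rcost e"
| "cost (IStore x d e) = 1 + icost d + icost e"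
| "cost (RStore x d e) = 1 + icost d + rcost e"
| "cost (Seq c d) = 1 + cost c + cost d"
| "cost (Cond b c d) = 1 + bcost b + cost c + cost d"
| "cost (While b c) = 1 + bcost b + cost c"

text \<open>Upper bounds replace exact running times, which depend on the branches taken.\<close>

definition runs :: "com \<Rightarrow> state \<Rightarrow> nat \<Rightarrow> state \<Rightarrow> bool" where
  "runs c st K st' \<longleftrightarrow> (\<exists>k\<le>K. exec c st k st')"

lemma runsI: "exec c st k st' \<Longrightarrow> k \<le> K \<Longrightarrow> runs c st K st'"
  unfolding runs_def by blast

lemma runs_while_free: "while_free c \<Longrightarrow> runs c st (cost c) (effect c st)"
proof (induction c arbitrary: st)
  case (Seq c d)
  then obtain k k' where "k \<le> cost c" "exec c st k (effect c st)"
    "k' \<le> cost d" "exec d (effect c st) k' (effect d (effect c st))"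
    unfolding runs_def by (metis while_free.simps(6))
  then show ?case
    using exec_Seq unfolding runs_def by (intro exI[of _ "1 + k + k'"]) auto
next
  case (Cond b c d)
  show ?case
  proof (cases "bval b st")
    case True
    with Cond obtain k where "k \<le> cost c" "exec c st k (effect c st)" by (auto simp: runs_def)
    then show ?thesis using True exec_CondTrue unfolding runs_def
      by (intro exI[of _ "1 + bcost b + k"]) auto
  next
    case False
    with Cond obtain k where "k \<le> cost d" "exec d st k (effect d st)" by (auto simp: runs_def)
    then show ?thesis using False exec_CondFalse unfolding runs_def
      by (intro exI[of _ "1 + bcost b + k"]) auto
  qed
next
  case Skip
  show ?case unfolding effect.simps using exec_Skip by (rule runsI) simp
next
  case (IAssign x e)
  show ?case unfolding effect.simps using exec_IAssign by (rule runsI) simp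
next
  case (RAssign x e)
  show ?case unfolding effect.simps using exec_RAssign by (rule runsI) simp
next
  case (IStore x d e)
  show ?case unfolding effect.simps using exec_IStore by (rule runsI) simp
next
  case (RStore x d e)
  show ?case unfolding effect.simps using exec_RStore by (rule runsI) simp
qed simp

lemma runs_Seq: "runs c st K st' \<Longrightarrow> runs d st' K' st'' \<Longrightarrow> runs (Seq c d) st (1 + K + K') st''"
  unfolding runs_def using exec_Seq by (metis add_le_mono order_refl)

text \<open>The invariant counts the iterations, so the body runs exactly \<open>N\<close> times.
  The extra 1 in \<open>N + 1\<close> pays for the failing test.\<close>

lemma runs_While:
  assumes "while_free c" "I (0 :: nat) st"
    and step: "\<And>i st. i < N \<Longrightarrow> I i st \<Longrightarrow> bval b st \<and> I (Suc i) (effect c st)"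
    and stop: "\<And>st. I N st \<Longrightarrow> \<not> bval b st"
  obtains st' where "runs (While b c) st ((N + 1) * (1 + bcost b + cost c)) st'" "I N st'"
proof -
  have "\<exists>st'. runs (While b c) st ((d + 1) * (1 + bcost b + cost c)) st' \<and> I N st'"
    if "i \<le> N" "d = N - i" "I i st" for d i st
    using that
  proof (induction d arbitrary: i st)
    case 0
    then have "I N st" by simp
    then have "exec (While b c) st (1 + bcost b) st" using stop exec_WhileFalse by blast
    then have "runs (While b c) st ((0 + 1) * (1 + bcost b + cost c)) st" by (rule runsI) simp
    then show ?case using \<open>I N st\<close> by blast
  next
    case (Suc d)
    then have "i < N" by simp
    note body = step[OF this Suc.prems(3)]
    then obtain st' where st': "runs (While b c) (effect c st) ((d + 1) * (1 + bcost b + cost c)) st'" "I N st'"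
    proof -
      have "Suc i \<le> N" "d = N - Suc i" using \<open>i < N\<close> Suc.prems(2) by simp_all
      from Suc.IH[OF this conjunct2[OF body]] show ?thesis using that by blast
    qed
    obtain k where k: "k \<le> cost c" "exec c st k (effect c st)"
      using runs_while_free[OF assms(1)] by (auto simp: runs_def)
    obtain k' where k': "k' \<le> (d + 1) * (1 + bcost b + cost c)" "exec (While b c) (effect c st) k' st'"
      using st'(1) by (auto simp: runs_def)
    have "exec (While b c) st (1 + bcost b + k + k') st'"
      using exec_WhileTrue k(2) k'(2) body by blast
    moreover have "1 + bcost b + k + k' \<le> (Suc d + 1) * (1 + bcost b + cost c)"
      using k(1) k'(1) by simp
    ultimately show ?case using st'(2) unfolding runs_def by blast
  qed
  from this[of 0 N st] that assms(2) show thesis by auto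
qed

section \<open>The program\<close>

abbreviation inc :: "vname \<Rightarrow> com" where
  "inc x \<equiv> IAssign x (IAdd (IVar x) (IConst 1))"

abbreviation pile :: rexp where
  "pile \<equiv> RGet ''p'' (IVar ''j'')"

definition total_guard :: bexp where
  "total_guard = ILess (IVar ''j'') (IVar ''n'')"

definition total_body :: com where
  "total_body = Seq (inc ''j'') (RAssign ''P'' (RAdd (RVar ''P'') pile))"

text \<open>With \<open>a\<close> the total length of the first \<open>k\<close> stockpiles, the
  test looks ahead to stockpile \<open>k + 1\<close>. The loop thus ends one index early, which
  \<open>choose_layout\<close> corrects.\<close>

definition median_guard :: bexp where
  "median_guard = RLess (RMul (RConst 2)
     (RAdd (RVar ''a'') (RGet ''p'' (IAdd (IVar ''k'') (IConst 1))))) (RVar ''P'')"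

definition median_body :: com where
  "median_body = Seq (inc ''k'') (RAssign ''a'' (RAdd (RVar ''a'') (RGet ''p'' (IVar ''k''))))"

definition set_layout :: "rexp \<Rightarrow> rexp \<Rightarrow> rexp \<Rightarrow> rexp \<Rightarrow> nat \<Rightarrow> nat \<Rightarrow> com" where
  "set_layout e0 e1 es ee d e =
     Seq (RAssign ''y0'' e0) (Seq (RAssign ''y1'' e1) (Seq (RAssign ''xs'' es)
       (Seq (RAssign ''xe'' ee) (Seq (IAssign ''qk'' (IConst d)) (IAssign ''qs'' (IConst e))))))"

text \<open>The cases with \<open>c < a\<close> are the reversed ones: \<open>k\<close> is traversed
  from right to left and the suffix starts at 0. If \<open>b + c > L\<close>, the prefix occupies
  \<open>[c, c + a]\<close> on the pad of the suffix; otherwise it starts at 0 on the other pad.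
  Resetting \<open>j\<close> prepares the last loop.\<close>

definition choose_layout :: com where
  "choose_layout =
     Seq (inc ''k'') (Seq (RAssign ''b'' (RGet ''p'' (IVar ''k'')))
     (Seq (RAssign ''c'' (RSub (RSub (RVar ''P'') (RVar ''a'')) (RVar ''b'')))
     (Seq (IAssign ''j'' (IConst 0))
     (Cond (RLess (RVar ''c'') (RVar ''a''))
       (Cond (RLess (RVar ''L'') (RAdd (RVar ''b'') (RVar ''c'')))
         (set_layout (RVar ''c'') (RConst 0) (RVar ''L'') (RSub (RVar ''L'') (RVar ''b'')) 2 1)
         (set_layout (RConst 0) (RConst 0) (RAdd (RVar ''b'') (RVar ''c'')) (RVar ''c'') 2 2))
       (Cond (RLess (RVar ''L'') (RAdd (RVar ''a'') (RVar ''b'')))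
         (set_layout (RConst 0) (RVar ''a'') (RSub (RVar ''L'') (RVar ''b'')) (RVar ''L'') 2 1)
         (set_layout (RConst 0) (RConst 0) (RVar ''a'') (RAdd (RVar ''a'') (RVar ''b'')) 1 2))))))"

text \<open>Breakpoint 0 is the point \<open>(0, 0)\<close> already present in the zero-initialised
  memory, so recording starts at index 1.\<close>

definition record_point :: com where
  "record_point = Seq (inc ''m'') (Seq (RStore ''t'' (IVar ''m'') (RVar ''T''))
     (RStore ''x'' (IVar ''m'') (RVar ''z'')))"

definition move_to :: "rexp \<Rightarrow> com" where
  "move_to d = Seq (RAssign ''T'' (RAdd (RVar ''T'') (RDiv d (RVar ''s''))))
     (Seq (RAssign ''z'' (RVar ''u'')) record_point)"

text \<open>No breakpoint is recorded for a journey of length 0, because breakpoints are strictly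
  increasing.\<close>

definition go :: com where
  "go = Cond (RLess (RVar ''z'') (RVar ''u'')) (move_to (RSub (RVar ''u'') (RVar ''z'')))
     (Cond (RLess (RVar ''u'') (RVar ''z'')) (move_to (RSub (RVar ''z'') (RVar ''u''))) Skip)"

text \<open>Until the last assignment \<open>S\<close> excludes stockpile \<open>j\<close>, so
  \<open>P\<close> minus the sum of \<open>S\<close> and the length of \<open>j\<close> is the total
  length after \<open>j\<close>.\<close>

definition place :: com where
  "place =
     Seq (inc ''j'')
     (Seq (Cond (ILess (IVar ''j'') (IVar ''k''))
       (Seq (RAssign ''u'' (RAdd (RVar ''y0'') (RVar ''S'')))
       (Seq (RAssign ''w'' (RAdd (RVar ''u'') pile)) (IStore ''pad'' (IVar ''j'') (IConst 1))))
       (Cond (ILess (IVar ''k'') (IVar ''j''))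
         (Seq (RAssign ''w'' (RAdd (RVar ''y1'') (RSub (RVar ''P'') (RAdd (RVar ''S'') pile))))
         (Seq (RAssign ''u'' (RAdd (RVar ''w'') pile)) (IStore ''pad'' (IVar ''j'') (IVar ''qs''))))
         (Seq (RAssign ''u'' (RVar ''xs''))
         (Seq (RAssign ''w'' (RVar ''xe'')) (IStore ''pad'' (IVar ''j'') (IVar ''qk''))))))
     (Seq (Cond (RLess (RVar ''w'') (RVar ''u''))
       (RStore ''l'' (IVar ''j'') (RVar ''w'')) (RStore ''l'' (IVar ''j'') (RVar ''u'')))
     (RAssign ''S'' (RAdd (RVar ''S'') pile))))"

definition reclaim :: com where
  "reclaim = Seq (RAssign ''T'' (RAdd (RVar ''T'') pile))
     (Seq (RAssign ''z'' (RVar ''w'')) record_point)"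

definition emit_body :: com where
  "emit_body = Seq place (Seq go reclaim)"

definition return_home :: com where
  "return_home = Seq (RAssign ''u'' (RConst 0)) go"

definition program :: com where
  "program = Seq (While total_guard total_body) (Seq (While median_guard median_body)
     (Seq choose_layout (Seq (While total_guard emit_body) return_home)))"

definition time_bound :: "nat \<Rightarrow> nat" where
  "time_bound n =
     1 + (n + 1) * (1 + bcost total_guard + cost total_body) +
     (1 + (n + 1) * (1 + bcost median_guard + cost median_body) +
     (1 + cost choose_layout +
     (1 + (n + 1) * (1 + bcost total_guard + cost emit_body) + cost return_home)))"

lemma time_bound_linear: "(\<lambda>n. real (time_bound n)) \<in> O(\<lambda>n. real n)"
proof -
  define K where "K = (1 + bcost total_guard + cost total_body) +
    (1 + bcost median_guard + cost median_body) + (1 + bcost total_guard + cost emit_body)"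
  define K' where "K' = 4 + cost choose_layout + cost return_home"
  have eq: "time_bound n = K' + (n + 1) * K" for n
    unfolding time_bound_def K_def K'_def by (simp add: algebra_simps)
  \<comment> \<open>For \<open>n = 0\<close> the constant part is not absorbed, so the domination
    starts at \<open>n = 1\<close>.\<close>
  have "time_bound n \<le> (K' + 2 * K) * n" if "1 \<le> n" for n
  proof -
    have "K' * 1 \<le> K' * n" "K * 1 \<le> K * n" using that by (intro mult_le_mono order_refl; simp)+
    then show ?thesis unfolding eq distrib_right mult_2 by (simp only: mult_1_right mult_1_left mult.commute)
  qed
  then have "eventually (\<lambda>n. norm (real (time_bound n)) \<le> real (K' + 2 * K) * norm (real n)) sequentially"
    by (intro eventually_sequentiallyI[of 1])
       (metis norm_of_nat of_nat_le_iff of_nat_mult)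
  then show ?thesis by (rule bigoI)
qed

section \<open>Computing the total length and the distinguished stockpile\<close>

lemmas total_defs = total_guard_def total_body_def
lemmas median_defs = median_guard_def median_body_def

lemma total_loop:
  assumes "ivar st ''j'' = 0" "ivar st ''n'' = n" "rvar st ''P'' = 0" "rarr st ''p'' = q"
  shows "runs (While total_guard total_body) st
      ((n + 1) * (1 + bcost total_guard + cost total_body))
      (st\<lparr>ivar := (ivar st)(''j'' := n), rvar := (rvar st)(''P'' := \<Sum>i=1..n. q i)\<rparr>)"
proof -
  define I where "I i st' \<longleftrightarrow>
    st' = st\<lparr>ivar := (ivar st)(''j'' := i), rvar := (rvar st)(''P'' := \<Sum>h=1..i. q h)\<rparr>" for i st'
  have "I 0 st" using assms by (simp add: I_def fun_upd_idem)
  moreover have "bval total_guard st' \<and> I (Suc i) (effect total_body st')" if "i < n" "I i st'" for i st'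
    using that assms by (simp add: I_def total_defs)
  moreover have "\<not> bval total_guard st'" if "I n st'" for st'
    using that assms by (simp add: I_def total_defs)
  moreover have "while_free total_body" by (simp add: total_defs)
  ultimately obtain st' where "runs (While total_guard total_body) st
      ((n + 1) * (1 + bcost total_guard + cost total_body)) st'" "I n st'"
    using runs_While[of total_body I st n total_guard] by blast
  then show ?thesis by (simp add: I_def)
qed

text \<open>By \<open>less\<close> and \<open>ge\<close>, \<open>Suc h\<close> is the first index at
  which twice the prefix sum reaches \<open>P\<close>, so exactly \<open>h\<close> iterations take
  place.\<close>

lemma median_loop:
  assumes "ivar st ''k'' = 0" "rvar st ''a'' = 0" "rarr st ''p'' = q"
    and less: "\<And>i. i < h \<Longrightarrow> 2 * (\<Sum>g=1..Suc i. q g) < rvar st ''P''"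
    and ge: "\<not> 2 * (\<Sum>g=1..Suc h. q g) < rvar st ''P''"
  shows "runs (While median_guard median_body) st
      ((h + 1) * (1 + bcost median_guard + cost median_body))
      (st\<lparr>ivar := (ivar st)(''k'' := h), rvar := (rvar st)(''a'' := \<Sum>i=1..h. q i)\<rparr>)"
proof -
  define I where "I i st' \<longleftrightarrow>
    st' = st\<lparr>ivar := (ivar st)(''k'' := i), rvar := (rvar st)(''a'' := \<Sum>h=1..i. q h)\<rparr>" for i st'
  have "I 0 st" using assms by (simp add: I_def fun_upd_idem)
  moreover have "bval median_guard st' \<and> I (Suc i) (effect median_body st')" if "i < h" "I i st'" for i st'
    using that assms(1-3) less[of i] by (simp add: I_def median_defs)
  moreover have "\<not> bval median_guard st'" if "I h st'" for st'
    using that assms(1-3) ge by (simp add: I_def median_defs)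
  moreover have "while_free median_body" by (simp add: median_defs)
  ultimately obtain st' where "runs (While median_guard median_body) st
      ((h + 1) * (1 + bcost median_guard + cost median_body)) st'" "I h st'"
    using runs_While[of median_body I st h median_guard] by blast
  then show ?thesis by (simp add: I_def)
qed

section \<open>Emitting the schedule\<close>

lemmas emit_defs = move_to_def record_point_def

context stockpile_walk
begin

text \<open>The segment numbers \<open>f\<close> are not stored by the program, hence the
  quantifier. The variables \<open>T\<close> and \<open>z\<close> hold the last breakpoint.\<close>

definition tracks :: "nat \<Rightarrow> state \<Rightarrow> bool" where
  "tracks j st \<longleftrightarrow>
     (\<exists>f. walk_prefix j (ivar st ''m'') (rarr st ''t'') (rarr st ''x'') f) \<and>
     rarr st ''t'' (ivar st ''m'') = rvar st ''T'' \<and> rarr st ''x'' (ivar st ''m'') = rvar st ''z''"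

lemma effect_go:
  assumes "tracks j st" "rvar st ''s'' = s" "rvar st ''u'' \<in> {0..L}"
  shows "tracks j (effect go st)"
    and "rvar (effect go st) ''z'' = rvar st ''u''"
    and "rvar (effect go st) ''T'' = rvar st ''T'' + \<bar>rvar st ''u'' - rvar st ''z''\<bar> / s"
    and "v \<noteq> ''m'' \<Longrightarrow> ivar (effect go st) v = ivar st v"
    and "v \<noteq> ''T'' \<Longrightarrow> v \<noteq> ''z'' \<Longrightarrow> rvar (effect go st) v = rvar st v"
    and "iarr (effect go st) = iarr st"
    and "v \<noteq> ''t'' \<Longrightarrow> v \<noteq> ''x'' \<Longrightarrow> rarr (effect go st) v = rarr st v"
proof -
  show "tracks j (effect go st)"
  proof (cases "rvar st ''z'' = rvar st ''u''")
    case True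
    then show ?thesis using assms(1) by (simp add: go_def)
  next
    case False
    obtain f where f: "walk_prefix j (ivar st ''m'') (rarr st ''t'') (rarr st ''x'') f"
      using assms(1) by (auto simp: tracks_def)
    show ?thesis
      using walk_prefix_travel[OF f assms(3)] False assms(1,2)
      by (auto simp: tracks_def go_def emit_defs)
  qed
qed (use assms in \<open>auto simp: go_def emit_defs\<close>)

lemma effect_reclaim:
  assumes "tracks j st" "Suc j \<le> n" "ivar st ''j'' = Suc j" "rarr st ''p'' = q"
    and "rvar st ''z'' = u (Suc j)" "rvar st ''w'' = w (Suc j)"
  shows "tracks (Suc j) (effect reclaim st)"
    and "rvar (effect reclaim st) ''z'' = w (Suc j)"
    and "rvar (effect reclaim st) ''T'' = rvar st ''T'' + q (Suc j)"
    and "v \<noteq> ''m'' \<Longrightarrow> ivar (effect reclaim st) v = ivar st v"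
    and "v \<noteq> ''T'' \<Longrightarrow> v \<noteq> ''z'' \<Longrightarrow> rvar (effect reclaim st) v = rvar st v"
    and "iarr (effect reclaim st) = iarr st"
    and "v \<noteq> ''t'' \<Longrightarrow> v \<noteq> ''x'' \<Longrightarrow> rarr (effect reclaim st) v = rarr st v"
proof -
  obtain f where f: "walk_prefix j (ivar st ''m'') (rarr st ''t'') (rarr st ''x'') f"
    using assms(1) by (auto simp: tracks_def)
  show "tracks (Suc j) (effect reclaim st)"
    using walk_prefix_reclaim[OF f assms(2)] assms
    by (auto simp: tracks_def reclaim_def emit_defs)
qed (use assms in \<open>auto simp: reclaim_def emit_defs\<close>)

end

context layout
begin

text \<open>The invariant of the last loop. The time \<open>T\<close> splits into reclaiming time
  \<open>S j\<close> and travel time \<open>travel j / s\<close>; \<open>w 0 = 0\<close> makes it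
  hold initially.\<close>

definition emitted :: "nat \<Rightarrow> state \<Rightarrow> bool" where
  "emitted j st \<longleftrightarrow> tracks j st \<and>
     ivar st ''n'' = n \<and> ivar st ''j'' = j \<and> ivar st ''k'' = k \<and>
     ivar st ''qk'' = qk \<and> ivar st ''qs'' = qs \<and>
     rvar st ''s'' = s \<and> rvar st ''P'' = S n \<and> rvar st ''y0'' = y0 \<and> rvar st ''y1'' = y1 \<and>
     rvar st ''xs'' = xs \<and> rvar st ''xe'' = xe \<and> rvar st ''S'' = S j \<and>
     rvar st ''z'' = w j \<and> rvar st ''T'' = S j + travel j / s \<and> rarr st ''p'' = q \<and>
     (\<forall>i\<in>{1..j}. iarr st ''pad'' i = pad i \<and> rarr st ''l'' i = min (u i) (w i))"

lemma effect_place: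
  assumes "emitted j st"
  defines "st' \<equiv> effect place st"
  shows "ivar st' = (ivar st)(''j'' := Suc j)"
    and "rvar st' ''u'' = u (Suc j)" "rvar st' ''w'' = w (Suc j)" "rvar st' ''S'' = S (Suc j)"
    and "iarr st' ''pad'' = (iarr st ''pad'')(Suc j := pad (Suc j))"
    and "rarr st' ''l'' = (rarr st ''l'')(Suc j := min (u (Suc j)) (w (Suc j)))"
    and "v \<notin> {''u'', ''w'', ''S''} \<Longrightarrow> rvar st' v = rvar st v"
    and "v \<noteq> ''l'' \<Longrightarrow> rarr st' v = rarr st v"
  using assms(1) unfolding st'_def emitted_def
  by (auto simp: place_def u_def w_def pad_def min_def algebra_simps)

lemma emitted_Suc:
  assumes em: "emitted j st" and "j < n"
  shows "emitted (Suc j) (effect emit_body st)"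
proof -
  define st1 where "st1 = effect place st"
  define st2 where "st2 = effect go st1"
  note place = effect_place[OF em, folded st1_def]
  have 1: "tracks j st1" "rvar st1 ''s'' = s" "rvar st1 ''u'' \<in> {0..L}"
    using em place range(1)[of "Suc j"] assms(2) by (auto simp: emitted_def tracks_def)
  note go = effect_go[OF 1, folded st2_def]
  have 2: "tracks j st2" "Suc j \<le> n" "ivar st2 ''j'' = Suc j" "rarr st2 ''p'' = q"
    "rvar st2 ''z'' = u (Suc j)" "rvar st2 ''w'' = w (Suc j)"
    using em place go assms(2) by (auto simp: emitted_def)
  note reclaim = effect_reclaim[OF 2]
  have eff: "effect emit_body st = effect reclaim st2"
    by (simp add: emit_body_def st1_def st2_def)
  have T: "rvar (effect reclaim st2) ''T'' = S (Suc j) + travel (Suc j) / s"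
    using reclaim(3) go(3) place em by (simp add: emitted_def add_divide_distrib)
  have arr: "iarr (effect reclaim st2) ''pad'' i = pad i \<and>
      rarr (effect reclaim st2) ''l'' i = min (u i) (w i)" if "i \<in> {1..Suc j}" for i
    using that em reclaim(6,7) go(6,7) place(5,6) by (cases "i = Suc j") (auto simp: emitted_def)
  show ?thesis
    unfolding eff emitted_def[of "Suc j"]
    using em reclaim(1,2,4,5,7) go(4,5,7) place(1,4,7,8) T arr by (simp add: emitted_def)
qed

lemma effect_return_home:
  assumes em: "emitted n st"
  defines "st' \<equiv> effect return_home st"
  shows "tracks n st'" "rvar st' ''z'' = 0" "rvar st' ''T'' = S n + (travel n + \<bar>w n\<bar>) / s"
    and "iarr st' = iarr st" "rarr st' ''l'' = rarr st ''l''"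
proof -
  let ?st = "effect (RAssign ''u'' (RConst 0)) st"
  have 1: "tracks n ?st" "rvar ?st ''s'' = s" "rvar ?st ''u'' \<in> {0..L}"
    using em range(2) by (auto simp: emitted_def tracks_def)
  note go = effect_go[OF 1]
  have eq: "st' = effect go ?st" by (simp add: st'_def return_home_def)
  show "tracks n st'" "rvar st' ''z'' = 0" "rvar st' ''T'' = S n + (travel n + \<bar>w n\<bar>) / s"
    "iarr st' = iarr st" "rarr st' ''l'' = rarr st ''l''"
    using go em unfolding eq by (simp_all add: emitted_def add_divide_distrib)
qed

end

section \<open>Feasibility and travel distance of the four layouts\<close>

lemma sum_split_at:
  fixes q :: "nat \<Rightarrow> real"
  assumes "j \<le> n"
  shows "(\<Sum>i=1..n. q i) = (\<Sum>i=1..j. q i) + (\<Sum>i=j+1..n. q i)"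
proof -
  have "{1..n} = {1..j} \<union> {j+1..n}" using assms by auto
  then show ?thesis by (subst sum.union_disjoint[symmetric]) auto
qed

text \<open>If \<open>a + b\<close> (or \<open>b + c\<close>) exceeds \<open>L\<close>, then \<open>b \<le> L\<close> and \<open>a + b + c \<le> 3 * L / 2\<close> leave
  room for the prefix and the suffix next to each other on one pad.\<close>

lemma layout_cases:
  fixes q :: "nat \<Rightarrow> real" and L s :: real and n h :: nat
  defines "P \<equiv> (\<Sum>i=1..n. q i)" and "a \<equiv> (\<Sum>i=1..h. q i)" and "b \<equiv> q (Suc h)"
  defines "c \<equiv> P - a - b"
  assumes "1 \<le> s" "0 \<le> L" "\<And>j. 0 \<le> q j" "\<And>j. j \<in> {1..n} \<Longrightarrow> 0 < q j" "\<And>j. j \<notin> {1..n} \<Longrightarrow> q j = 0"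
    and "1 \<le> n \<Longrightarrow> Suc h \<le> n" "1 \<le> n \<or> h = 0"
    and "b \<le> L" "2 * P \<le> 3 * L" "P \<le> 2 * (a + b)" "a = 0 \<or> 2 * a < P"
  shows "c < a \<Longrightarrow> L < b + c \<Longrightarrow> layout L s n q (Suc h) c 0 L (L - b) 2 1"
    and "c < a \<Longrightarrow> \<not> L < b + c \<Longrightarrow> layout L s n q (Suc h) 0 0 (b + c) c 2 2"
    and "\<not> c < a \<Longrightarrow> L < a + b \<Longrightarrow> layout L s n q (Suc h) 0 a (L - b) L 2 1"
    and "\<not> c < a \<Longrightarrow> \<not> L < a + b \<Longrightarrow> layout L s n q (Suc h) 0 0 a (a + b) 1 2"
proof -
  have a: "(\<Sum>i=1..Suc h-1. q i) = a" by (simp add: a_def)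
  have ab: "(\<Sum>i=1..Suc h. q i) = a + b" by (simp add: a_def b_def)
  have c: "(\<Sum>i=Suc h+1..n. q i) = c" and bc: "(\<Sum>i=Suc h..n. q i) = b + c"
  proof -
    show "(\<Sum>i=Suc h+1..n. q i) = c"
    proof (cases "1 \<le> n")
      case True
      then show ?thesis using sum_split_at[of "Suc h" n q] assms(10) ab by (simp add: c_def P_def)
    next
      case False
      then show ?thesis using assms(9,11) by (simp add: c_def P_def a_def b_def)
    qed
    show "(\<Sum>i=Suc h..n. q i) = b + c"
    proof (cases "1 \<le> n")
      case True
      then show ?thesis using sum_split_at[of h n q] assms(10) a by (simp add: c_def P_def)
    next
      case False
      then show ?thesis using assms(9,11) by (simp add: c_def P_def a_def b_def)
    qed
  qed
  have nonneg: "0 \<le> a" "0 \<le> b" "0 \<le> c"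
    using assms(7) unfolding c[symmetric] by (auto simp: a_def b_def intro!: sum_nonneg)
  have P: "(\<Sum>i=1..n. q i) = a + b + c" by (simp add: c_def P_def)
  have le: "2 * (a + b + c) \<le> 3 * L" "c \<le> a + b" "a = 0 \<or> a < b + c"
    using assms(13-15) by (auto simp: c_def)
  note base = assms(5,7-10,12) nonneg le
  \<comment> \<open>From \<open>b + c > L\<close> follows \<open>a < L / 2\<close>, so
    \<open>a + c < L\<close>. The travel distance is
    \<open>c + (L - c - a) + (b + c - L) = b + c - a\<close>, that is
    \<open>2 * (b + c) - P\<close>.\<close>
  show "layout L s n q (Suc h) c 0 L (L - b) 2 1" if "c < a" "L < b + c"
    by unfold_locales (use that base in \<open>simp_all only: a ab c bc P\<close>, auto simp: b_def[symmetric])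
  \<comment> \<open>Here \<open>a < b + c \<le> L\<close>, so the prefix fits and the travel
    distance is again \<open>b + c - a\<close>.\<close>
  show "layout L s n q (Suc h) 0 0 (b + c) c 2 2" if "c < a" "\<not> L < b + c"
    by unfold_locales (use that base in \<open>simp_all only: a ab c bc P\<close>, auto simp: b_def[symmetric])
  \<comment> \<open>Now \<open>c < L / 2\<close>, so \<open>a + c < L\<close>, and the travel
    distance is \<open>a + b - c = 2 * (a + b) - P\<close>.\<close>
  show "layout L s n q (Suc h) 0 a (L - b) L 2 1" if "\<not> c < a" "L < a + b"
    by unfold_locales (use that base in \<open>simp_all only: a ab c bc P\<close>, auto simp: b_def[symmetric])
  \<comment> \<open>The suffix fits because \<open>c \<le> a + b \<le> L\<close>; the travel
    distance is again \<open>a + b - c\<close>.\<close>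
  show "layout L s n q (Suc h) 0 0 a (a + b) 1 2" if "\<not> c < a" "\<not> L < a + b"
    by unfold_locales (use that base in \<open>simp_all only: a ab c bc P\<close>, auto simp: b_def[symmetric])
qed

section \<open>Correctness, running time and optimality of the program\<close>

theorem theorem17:
  "\<exists>(prog :: com) (T :: nat \<Rightarrow> nat).
     (\<lambda>n. real (T n)) \<in> O(\<lambda>n. real n) \<and>
     (\<forall>(L :: int) (s :: real) (n :: nat) (p :: nat \<Rightarrow> int).
        reclaimer_instance L s n p \<and> real_of_int (\<Sum>j=1..n. p j) \<le> 3 * real_of_int L / 2 \<longrightarrow>
        (\<exists>k st pad l C H.
           k \<le> T n \<and> exec prog (input_state L s n p) k st \<and>
           outputs_solution st n pad l C H \<and>
           optimal_solution L s n p pad l C H))"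
proof (rule exI[of _ program], rule exI[of _ time_bound], intro conjI allI impI)
  show "(\<lambda>n. real (time_bound n)) \<in> O(\<lambda>n. real n)" by (rule time_bound_linear)
  fix L :: int and s :: real and n :: nat and p :: "nat \<Rightarrow> int"
  assume inst: "reclaimer_instance L s n p \<and> real_of_int (\<Sum>j=1..n. p j) \<le> 3 * real_of_int L / 2"
  \<comment> \<open>Continued by 0 outside the instance, as in the input memory.\<close>
  define q where "q = (\<lambda>j. if j \<in> {1..n} then real_of_int (p j) else 0)"
  define P where "P = (\<Sum>j=1..n. q j)"
  \<comment> \<open>Stockpile \<open>Suc h\<close> is the one at which the lower bound is
    attained.\<close>
  define h where "h = (LEAST h. P \<le> 2 * (\<Sum>j=1..Suc h. q j))"
  let ?st0 = "input_state L s n p"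
  have L: "0 < L" and s: "1 \<le> s" and p: "\<And>j. j \<in> {1..n} \<Longrightarrow> 0 < p j \<and> p j \<le> L"
    using inst by (auto simp: reclaimer_instance_def)
  have q_p: "\<And>j. j \<in> {1..n} \<Longrightarrow> q j = real_of_int (p j)"
    and q_pos: "\<And>j. j \<in> {1..n} \<Longrightarrow> 0 < q j" and q_outside: "\<And>j. j \<notin> {1..n} \<Longrightarrow> q j = 0"
    using p by (auto simp: q_def)
  have q_nonneg: "0 \<le> q j" for j using q_pos[of j] q_outside[of j] by (cases "j \<in> {1..n}") auto
  have q_le: "q j \<le> real_of_int L" for j using p[of j] L by (auto simp: q_def)
  have "P = real_of_int (\<Sum>j=1..n. p j)" unfolding P_def of_int_sum using q_p by (intro sum.cong) auto
  then have P_le: "2 * P \<le> 3 * real_of_int L" using inst by simp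
  have P_nonneg: "0 \<le> P" using q_nonneg by (auto simp: P_def intro: sum_nonneg)
  \<comment> \<open>Index \<open>n - 1\<close> shows that the least \<open>h\<close> exists; for
    \<open>n = 0\<close> it is 0 by truncation, and both sides vanish.\<close>
  have ex: "P \<le> 2 * (\<Sum>j=1..Suc (n - 1). q j)"
  proof (cases "1 \<le> n")
    case True
    then show ?thesis using P_nonneg by (simp add: P_def)
  next
    case False
    then show ?thesis using q_nonneg[of 1] by (simp add: P_def)
  qed
  have h: "P \<le> 2 * (\<Sum>j=1..Suc h. q j)" unfolding h_def by (rule LeastI, rule ex)
  have h_less: "2 * (\<Sum>j=1..Suc i. q j) < P" if "i < h" for i
    using not_less_Least[of i "\<lambda>h. P \<le> 2 * (\<Sum>j=1..Suc h. q j)"] that unfolding h_def by simp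
  have h_le: "h \<le> n - 1" unfolding h_def by (rule Least_le, rule ex)
  define a where "a = (\<Sum>j=1..h. q j)"
  define b where "b = q (Suc h)"
  define c where "c = P - a - b"
  \<comment> \<open>For \<open>h > 0\<close> this is the minimality of \<open>h\<close>, applied to
    \<open>h - 1\<close>.\<close>
  have a_half: "a = 0 \<or> 2 * a < P"
    using h_less[of "h - 1"] by (cases h) (simp_all add: a_def)
  define st1 where "st1 = ?st0\<lparr>ivar := (ivar ?st0)(''j'' := n), rvar := (rvar ?st0)(''P'' := P)\<rparr>"
  define st2 where "st2 = st1\<lparr>ivar := (ivar st1)(''k'' := h), rvar := (rvar st1)(''a'' := a)\<rparr>"
  define st3 where "st3 = effect choose_layout st2"
  have run1: "runs (While total_guard total_body) ?st0
      ((n + 1) * (1 + bcost total_guard + cost total_body)) st1"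
    unfolding st1_def P_def by (rule total_loop) (auto simp: input_state_def q_def)
  have run2: "runs (While median_guard median_body) st1
      ((h + 1) * (1 + bcost median_guard + cost median_body)) st2"
    unfolding st2_def a_def
  proof (rule median_loop)
    show "rarr st1 ''p'' = q" by (auto simp: st1_def input_state_def q_def)
  qed (use h h_less in \<open>auto simp: st1_def input_state_def\<close>)
  have run3: "runs choose_layout st2 (cost choose_layout) st3"
    unfolding st3_def by (rule runs_while_free) (simp add: choose_layout_def set_layout_def)
  let ?lay = "layout (real_of_int L) s n q (Suc h)"
  have vars2: "rvar st2 ''P'' = P" "rvar st2 ''a'' = a" "rvar st2 ''L'' = real_of_int L"
    "rvar st2 ''s'' = s" "rvar st2 ''S'' = 0" "rvar st2 ''T'' = 0" "rvar st2 ''z'' = 0"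
    "ivar st2 ''k'' = h" "ivar st2 ''n'' = n" "ivar st2 ''m'' = 0"
    "rarr st2 ''p'' = q" "rarr st2 ''t'' 0 = 0" "rarr st2 ''x'' 0 = 0"
    by (auto simp: st2_def st1_def input_state_def q_def)
  have b_eq: "q (Suc h) = b" by (simp add: b_def)
  have vars3: "rvar st3 ''P'' = P" "rvar st3 ''s'' = s" "rvar st3 ''S'' = 0" "rvar st3 ''T'' = 0"
    "rvar st3 ''z'' = 0" "ivar st3 ''k'' = Suc h" "ivar st3 ''n'' = n" "ivar st3 ''m'' = 0"
    "ivar st3 ''j'' = 0" "rarr st3 ''p'' = q" "rarr st3 ''t'' 0 = 0" "rarr st3 ''x'' 0 = 0"
    unfolding st3_def choose_layout_def set_layout_def by (simp_all add: vars2)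
  have lay: "?lay (rvar st3 ''y0'') (rvar st3 ''y1'') (rvar st3 ''xs'') (rvar st3 ''xe'')
      (ivar st3 ''qk'') (ivar st3 ''qs'')"
  proof -
    note cases = layout_cases[of s "real_of_int L" q n h, folded P_def a_def b_def, folded c_def]
    have prems: "1 \<le> s" "0 \<le> real_of_int L" "1 \<le> n \<Longrightarrow> Suc h \<le> n" "1 \<le> n \<or> h = 0"
       "b \<le> real_of_int L" "P \<le> 2 * (a + b)"
      using s L h_le h q_le by (auto simp: a_def b_def)
    note cases = cases[OF prems(1,2) q_nonneg q_pos q_outside prems(3,4,5) P_le prems(6) a_half]
    consider "c < a" "L < b + c" | "c < a" "\<not> L < b + c" | "\<not> c < a" "L < a + b" | "\<not> c < a" "\<not> L < a + b"
      by blast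
    then show ?thesis
      by cases (use cases in \<open>simp_all add: st3_def choose_layout_def set_layout_def vars2 b_eq c_def\<close>)
  qed
  interpret layout "real_of_int L" s n q "Suc h" "rvar st3 ''y0''" "rvar st3 ''y1''" "rvar st3 ''xs''"
    "rvar st3 ''xe''" "ivar st3 ''qk''" "ivar st3 ''qs''"
    by (rule lay)
  have S_n: "S n = P" by (simp add: S_def P_def)
  have "emitted 0 st3"
    using walk_prefix_0[of "rarr st3 ''t''" "rarr st3 ''x''"] vars3 S_n
    by (simp add: emitted_def tracks_def travel_def w_def)
  then obtain st4 where run4: "runs (While total_guard emit_body) st3
      ((n + 1) * (1 + bcost total_guard + cost emit_body)) st4" and em: "emitted n st4"
  proof (rule runs_While[of emit_body emitted st3 n total_guard, rotated])
    show "bval total_guard st \<and> emitted (Suc i) (effect emit_body st)" if "i < n" "emitted i st" for i st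
      using emitted_Suc[OF that(2,1)] that by (simp add: total_guard_def emitted_def)
    show "\<not> bval total_guard st" if "emitted n st" for st
      using that by (simp add: total_guard_def emitted_def)
    show "while_free emit_body"
      by (simp add: emit_body_def place_def go_def reclaim_def emit_defs)
  qed
  define st5 where "st5 = effect return_home st4"
  have run5: "runs return_home st4 (cost return_home) st5"
    unfolding st5_def by (rule runs_while_free) (simp add: return_home_def go_def emit_defs)
  note home = effect_return_home[OF em, folded st5_def]
  have "(h + 1) * (1 + bcost median_guard + cost median_body)
      \<le> (n + 1) * (1 + bcost median_guard + cost median_body)"
    using h_le by (intro mult_le_mono) auto
  with run2 have run2': "runs (While median_guard median_body) st1
      ((n + 1) * (1 + bcost median_guard + cost median_body)) st2"
    unfolding runs_def using le_trans by blast
  have "runs program ?st0 (time_bound n) st5"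
    using runs_Seq[OF run1 runs_Seq[OF run2' runs_Seq[OF run3 runs_Seq[OF run4 run5]]]]
    by (simp only: program_def time_bound_def)
  then obtain k where k: "k \<le> time_bound n" "exec program ?st0 k st5" by (auto simp: runs_def)
  define pd where "pd = iarr st5 ''pad''"
  define l where "l = rarr st5 ''l''"
  define m where "m = ivar st5 ''m''"
  have out: "pd j = pad j" "l j = min (u j) (w j)" if "j \<in> {1..n}" for j
    using em that home(4,5) by (auto simp: emitted_def pd_def l_def)
  have placed: "valid_placement L n p pd l"
    by (rule valid_placement[OF q_p]) (use out in auto)
  obtain f where f: "walk_prefix n m (rarr st5 ''t'') (rarr st5 ''x'') f"
    and tm: "rarr st5 ''t'' m = S n + (travel n + \<bar>w n\<bar>) / s" and xm: "rarr st5 ''x'' m = 0"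
    using home by (auto simp: tracks_def m_def)
  define C where "C = rarr st5 ''t'' m"
  obtain H where bp: "breakpoints C m (rarr st5 ''t'')"
    and H: "interpolates m (rarr st5 ''t'') (rarr st5 ''x'') H" "valid_schedule L s n p l C H"
    using walk_prefix_schedule[OF f xm q_p refl out(2)] unfolding C_def by blast
  have opt: "C \<le> C'" if feas: "feasible_solution L s n p pad' l' C' H'" for pad' l' C' H'
  proof (cases "1 \<le> n")
    case True
    then have kn: "Suc h \<in> {1..n}" using h_le by auto
    have sums: "(\<Sum>j=1..n. real_of_int (p j)) = S n"
      "(\<Sum>j=1..Suc h. real_of_int (p j)) = (\<Sum>j=1..Suc h. q j)"
      "(\<Sum>j=Suc h..n. real_of_int (p j)) = (\<Sum>j=Suc h..n. q j)"
      unfolding S_def using q_p kn by (auto intro!: sum.cong simp del: sum.cl_ivl_Suc)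
    show ?thesis
      using makespan_lower_bound[OF conjunct1[OF inst] feas kn] travel_total[OF True]
      unfolding sums C_def tm by linarith
  next
    case False
    \<comment> \<open>Without stockpiles there is no \<open>k\<close> for the lower bound, but the
      constructed makespan is 0.\<close>
    then have "n = 0" by simp
    note at_n = arg_cong[OF this]
    have "travel n = 0" "w n = 0" "S n = 0"
      using at_n[of travel] at_n[of w] at_n[of S] by (simp_all only: travel_def w_def S_def) simp_all
    then have "C = 0" by (simp add: C_def tm)
    then show ?thesis using feas by (simp add: feasible_solution_def valid_schedule_def)
  qed
  show "\<exists>k st pad l C H. k \<le> time_bound n \<and> exec program ?st0 k st \<and>
      outputs_solution st n pad l C H \<and> optimal_solution L s n p pad l C H"
  proof (intro exI conjI)
    show "k \<le> time_bound n" "exec program ?st0 k st5" by (fact k)+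
    show "outputs_solution st5 n pd l C H"
      using bp H(1) by (simp add: outputs_solution_def pd_def l_def m_def)
    show "optimal_solution L s n p pd l C H"
      using placed H(2) opt unfolding optimal_solution_def feasible_solution_def by blast
  qed
qed

end
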